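(* For every $n\ge0$, $F_{RB}$ is a bijection from $\mathrm{PW}_n$ onto the set of bicolored-packed forests of weight $n$ and $T_{RB}$ is a bijection from the irreducible packed words of length $n$ onto the bicolored-packed trees of weight $n$; their inverses are $F_{RB}^*$, $T_{RB}^*$ defined by $F_{RB}^*([])=\varepsilon$, $F_{RB}^*([t_1,\dots,t_k])=T_{RB}^*(t_1)\odot\cdots\odot T_{RB}^*(t_k)$ and $T_{RB}^*(\mathrm{Node}(c,f_\ell,f_r))=F_{RB}^*(f_\ell)\triangleleft_R\big(F_{RB}^*(f_r)\triangleleft_B c\big)$. The same holds with $F_{BR}$, $T_{BR}$ in place of $F_{RB}$, $T_{RB}$: they are bijections between the same sets.
   Context: Words over positive integers; $|w|$ length, $\max(w)$ largest letter ($\max(\varepsilon)=0$), $w^{[k]}$ adds $k$ to all letters. Packed: all integers $1..\max(w)$ occur; $\mathrm{PW}_n$ packed words of length $n$. $u\odot v=u^{[\max(v)]}\cdot v$. Global descent of $w\in\mathrm{PW}_n$: $1\le c\le n-1$ with all of $w_1..w_c$ strictly greater than all of $w_{c+1}..w_n$; irreducible = nonempty, no global descent; each packed $w$ is uniquely $w_1\odot\cdots\odot w_k$ with irreducible $w_j$. Red operation: for $w\in\mathrm{PW}_n$, $I=\{i_1<\dots<i_p\}\subseteq\{1..n+p\}$, $p\ge1$, $\phi_I(w)$ has letter $\max(w)+1$ at the positions in $I$ and the letters of $w$ in order elsewhere; nonempty packed $v$ is uniquely $\phi_I(v')$, and $u\triangleleft_R v=\phi_{I+|u|}(u\odot v')$.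 Blue operation: $\psi_{i^\circ}(w)$ ($1\le i\le\max(w)+1$) adds $1$ to letters $\ge i$ and appends $i$; $\psi_{i^\bullet}(w)=w\cdot i$ ($1\le i\le\max(w)$); nonempty packed $v$ is uniquely $\psi_{i^\alpha}(v')$, and $u\triangleleft_B v=\psi_{(i+\max(u))^\alpha}(v'\odot u)$. For irreducible $w$, the red- (resp. blue-) factorization is the unique pair $(u,v)$, $v\ne\varepsilon$, with $w=u\triangleleft_R v$ (resp. $u\triangleleft_B v$) and $|u|$ maximal. A packed word is red-irreducible (resp. blue-irreducible) if it is irreducible and $w=u\triangleleft_R v$ (resp. $u\triangleleft_B v$) with $v\neq\varepsilon$ forces $u=\varepsilon$. The red-blue-factorization of irreducible $w$ is $w=a\triangleleft_R(b\triangleleft_B c)$ where $(a,x)$ is the red-factorization of $w$ and $(b,c)$ the blue-factorization of $x$; the blue-red-factorization is $w=b\triangleleft_B(a\triangleleft_R c)$ where $(b,y)$ is the blue-factorization of $w$ and $(a,c)$ the red-factorization of $y$. Biplane trees $\mathrm{Node}(x,f_\ell,f_r)$ with ordered possibly empty left/right forests; forests are ordered lists. Bicolored-packed trees are labeled by packed words: $\mathrm{Node}(z,f_\ell,f_r)$ is bicolored-packed if either ($z=1$, $f_r=[]$, all trees of $f_\ell$ bicolored-packed) or ($z\ne1$ is both red- and blue-irreducible and all trees of $f_\ell,f_r$ bicolored-packed). Weight = sum of lengths of all labels. $F_{RB}(\varepsilon)=F_{BR}(\varepsilon)=[]$; for $w=w_1\odot\cdots\odot w_k$ irreducible decomposition,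 $F_{RB}(w)=[T_{RB}(w_1),\dots,T_{RB}(w_k)]$ and $F_{BR}(w)=[T_{BR}(w_k),\dots,T_{BR}(w_1)]$; for irreducible $w$ with red-blue-factorization $a\triangleleft_R(b\triangleleft_B c)$, $T_{RB}(w)=\mathrm{Node}(c,F_{RB}(a),F_{RB}(b))$; with blue-red-factorization $b\triangleleft_B(a\triangleleft_R c)$, $T_{BR}(w)=\mathrm{Node}(c,F_{BR}(b),F_{BR}(a))$. *)

theory Defs
  imports Main
begin

text \<open>
  Words are lists of natural numbers.  Positivity of the letters is part of packedness, and every
  operation below is only meaningful on packed words.  Positions are counted from 1.
\<close>

type_synonym word = "nat list"

definition wmax :: "word \<Rightarrow> nat" where
  "wmax w = (if w = [] then 0 else Max (set w))"

definition shift :: "nat \<Rightarrow> word \<Rightarrow> word" where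
  "shift k w = map (\<lambda>x. x + k) w"

definition packed :: "word \<Rightarrow> bool" where
  "packed w \<longleftrightarrow> set w = {1..wmax w}"

definition PW :: "nat \<Rightarrow> word set" where
  "PW n = {w. packed w \<and> length w = n}"

definition odot :: "word \<Rightarrow> word \<Rightarrow> word" (infixr \<open>\<odot>\<close> 65) where
  "u \<odot> v = shift (wmax v) u @ v"

definition global_descent :: "word \<Rightarrow> nat \<Rightarrow> bool" where
  "global_descent w c \<longleftrightarrow>
     1 \<le> c \<and> c < length w \<and> (\<forall>x \<in> set (take c w). \<forall>y \<in> set (drop c w). x > y)"

definition irreducible_word :: "word \<Rightarrow> bool" where
  "irreducible_word w \<longleftrightarrow> packed w \<and> w \<noteq> [] \<and> (\<nexists>c. global_descent w c)"

text \<open>The empty word is neutral for \<open>\<odot>\<close>, so the fold is the product of the listed words.\<close>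

definition odot_list :: "word list \<Rightarrow> word" where
  "odot_list ws = foldr (\<odot>) ws []"

definition irreducible_decomposition :: "word \<Rightarrow> word list" where
  "irreducible_decomposition w =
     (THE ws. (\<forall>x \<in> set ws. irreducible_word x) \<and> odot_list ws = w)"


subsection \<open>The red operation\<close>

text \<open>
  A position \<open>i \<notin> I\<close> carries the letter of \<open>w\<close> whose (0-based) index is the number of
  positions before \<open>i\<close> that are not in \<open>I\<close>.
\<close>

definition phi :: "nat set \<Rightarrow> word \<Rightarrow> word" where
  "phi I w = map (\<lambda>i. if i \<in> I then wmax w + 1 else w ! card ({1..<i} - I))
                 [1..<length w + card I + 1]"

definition phi_valid :: "nat set \<Rightarrow> word \<Rightarrow> bool" where
  "phi_valid I w \<longleftrightarrow> packed w \<and> I \<noteq> {} \<and> I \<subseteq> {1..length w + card I}"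

definition red_split :: "word \<Rightarrow> nat set \<times> word" where
  "red_split v = (THE (I, v'). phi_valid I v' \<and> v = phi I v')"

definition red_op :: "word \<Rightarrow> word \<Rightarrow> word" (infixr \<open>\<triangleleft>\<^sub>R\<close> 60) where
  "u \<triangleleft>\<^sub>R v = (case red_split v of (I, v') \<Rightarrow> phi ((\<lambda>i. i + length u) ` I) (u \<odot> v'))"


subsection \<open>The blue operation\<close>

datatype mark = Circ | Bullet

fun psi :: "nat \<Rightarrow> mark \<Rightarrow> word \<Rightarrow> word" where
  "psi i Circ w = map (\<lambda>x. if x \<ge> i then x + 1 else x) w @ [i]"
| "psi i Bullet w = w @ [i]"

fun psi_valid :: "nat \<Rightarrow> mark \<Rightarrow> word \<Rightarrow> bool" where
  "psi_valid i Circ w \<longleftrightarrow> packed w \<and> 1 \<le> i \<and> i \<le> wmax w + 1"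
| "psi_valid i Bullet w \<longleftrightarrow> packed w \<and> 1 \<le> i \<and> i \<le> wmax w"

definition blue_split :: "word \<Rightarrow> nat \<times> mark \<times> word" where
  "blue_split v = (THE (i, \<alpha>, v'). psi_valid i \<alpha> v' \<and> v = psi i \<alpha> v')"

definition blue_op :: "word \<Rightarrow> word \<Rightarrow> word" (infixr \<open>\<triangleleft>\<^sub>B\<close> 60) where
  "u \<triangleleft>\<^sub>B v = (case blue_split v of (i, \<alpha>, v') \<Rightarrow> psi (i + wmax u) \<alpha> (v' \<odot> u))"


subsection \<open>Factorizations\<close>

definition red_factors :: "word \<Rightarrow> word \<Rightarrow> word \<Rightarrow> bool" where
  "red_factors w u v \<longleftrightarrow> packed u \<and> packed v \<and> v \<noteq> [] \<and> w = u \<triangleleft>\<^sub>R v"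

definition blue_factors :: "word \<Rightarrow> word \<Rightarrow> word \<Rightarrow> bool" where
  "blue_factors w u v \<longleftrightarrow> packed u \<and> packed v \<and> v \<noteq> [] \<and> w = u \<triangleleft>\<^sub>B v"

definition red_factorization :: "word \<Rightarrow> word \<times> word" where
  "red_factorization w = (THE (u, v). red_factors w u v \<and>
     (\<forall>u' v'. red_factors w u' v' \<longrightarrow> length u' \<le> length u))"

definition blue_factorization :: "word \<Rightarrow> word \<times> word" where
  "blue_factorization w = (THE (u, v). blue_factors w u v \<and>
     (\<forall>u' v'. blue_factors w u' v' \<longrightarrow> length u' \<le> length u))"

definition red_irreducible :: "word \<Rightarrow> bool" where
  "red_irreducible w \<longleftrightarrow> irreducible_word w \<and> (\<forall>u v. red_factors w u v \<longrightarrow> u = [])"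

definition blue_irreducible :: "word \<Rightarrow> bool" where
  "blue_irreducible w \<longleftrightarrow> irreducible_word w \<and> (\<forall>u v. blue_factors w u v \<longrightarrow> u = [])"


subsection \<open>Bicolored-packed trees and forests\<close>

datatype 'a biplane_tree = Node 'a "'a biplane_tree list" "'a biplane_tree list"

type_synonym 'a biplane_forest = "'a biplane_tree list"

fun bicolored_packed :: "word biplane_tree \<Rightarrow> bool" where
  "bicolored_packed (Node z fl fr) \<longleftrightarrow>
     (z = [1] \<and> fr = [] \<and> (\<forall>t \<in> set fl. bicolored_packed t)) \<or>
     (z \<noteq> [1] \<and> red_irreducible z \<and> blue_irreducible z \<and>
      (\<forall>t \<in> set fl. bicolored_packed t) \<and> (\<forall>t \<in> set fr. bicolored_packed t))"

fun tree_weight :: "word biplane_tree \<Rightarrow> nat" where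
  "tree_weight (Node z fl fr) =
     length z + sum_list (map tree_weight fl) + sum_list (map tree_weight fr)"

definition forest_weight :: "word biplane_forest \<Rightarrow> nat" where
  "forest_weight f = sum_list (map tree_weight f)"

definition bicolored_packed_trees :: "nat \<Rightarrow> word biplane_tree set" where
  "bicolored_packed_trees n = {t. bicolored_packed t \<and> tree_weight t = n}"

definition bicolored_packed_forests :: "nat \<Rightarrow> word biplane_forest set" where
  "bicolored_packed_forests n = {f. (\<forall>t \<in> set f. bicolored_packed t) \<and> forest_weight f = n}"


subsection \<open>Existence and uniqueness of decompositions and factorizations\<close>

text \<open>
  The descriptions used above are all well-defined; this is also what makes the recursions below
  terminate.
\<close>

lemma wmax_Nil [simp]: "wmax [] = 0"
  by (simp add: wmax_def)

lemma wmax_ge: "x \<in> set w \<Longrightarrow> x \<le> wmax w"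
  by (auto simp: wmax_def)

lemma wmax_in: "w \<noteq> [] \<Longrightarrow> wmax w \<in> set w"
  by (simp add: wmax_def)

lemma wmax_eqI: "\<lbrakk>m \<in> set w; \<And>x. x \<in> set w \<Longrightarrow> x \<le> m\<rbrakk> \<Longrightarrow> wmax w = m"
  by (auto simp: wmax_def intro: Max_eqI)

lemma packed_wmax:
  assumes "set w = {1..m}"
  shows "wmax w = m"
proof (cases "m = 0")
  case True then show ?thesis using assms by simp
next
  case False then show ?thesis using assms by (intro wmax_eqI) auto
qed

lemma packed_iff: "packed w \<longleftrightarrow> (\<exists>m. set w = {1..m})"
  using packed_wmax by (auto simp: packed_def)

lemma packed_Nil [simp]: "packed []"
  by (simp add: packed_def)

lemma length_odot [simp]: "length (u \<odot> v) = length u + length v"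
  by (simp add: odot_def shift_def)

lemma Nil_odot [simp]: "[] \<odot> v = v"
  by (simp add: odot_def shift_def)

lemma odot_Nil [simp]: "u \<odot> [] = u"
  by (simp add: odot_def shift_def)

lemma set_odot:
  assumes "packed u" "packed v"
  shows "set (u \<odot> v) = {1..wmax u + wmax v}"
proof -
  have "(\<lambda>x. x + wmax v) ` {1..wmax u} = {1 + wmax v..wmax u + wmax v}"
    by (simp add: image_add_atLeastAtMost')
  then show ?thesis
    using assms by (auto simp: odot_def shift_def packed_def)
qed

lemma packed_odot: "packed u \<Longrightarrow> packed v \<Longrightarrow> packed (u \<odot> v)"
  using set_odot packed_iff by blast

lemma wmax_odot: "packed u \<Longrightarrow> packed v \<Longrightarrow> wmax (u \<odot> v) = wmax u + wmax v"
  using set_odot packed_wmax by blast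

lemma odot_inject:
  assumes "u \<odot> v = u' \<odot> v'" "length u = length u'"
  shows "u = u' \<and> v = v'"
proof -
  have "shift (wmax v) u = shift (wmax v') u'" "v = v'"
    using assms by (auto simp: odot_def shift_def)
  moreover have "inj (\<lambda>x::nat. x + k)" for k by (simp add: inj_def)
  ultimately show ?thesis by (simp add: shift_def inj_map_eq_map)
qed

lemma length_phi [simp]: "length (phi I w) = length w + card I"
  by (simp add: phi_def del: upt_Suc)

lemma nth_phi:
  assumes "i \<in> {1..length w + card I}"
  shows "phi I w ! (i - 1) = (if i \<in> I then wmax w + 1 else w ! card ({1..<i} - I))"
  using assms by (auto simp: phi_def simp del: upt_Suc)

lemma phi_gap_bij:
  assumes "I \<subseteq> {1..n + card I}"
  shows "bij_betw (\<lambda>i. card ({1..<i} - I)) ({1..n + card I} - I) {..<n}"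
proof -
  let ?g = "\<lambda>i. card ({1..<i} - I)" and ?C = "{1..n + card I} - I"
  have fin: "finite I" using assms finite_subset by blast
  have card: "card ?C = n"
    using assms fin by (simp add: card_Diff_subset)
  have less: "?g i < ?g j" if "i \<in> ?C" "i < j" for i j
  proof (rule psubset_card_mono)
    show "{1..<i} - I \<subset> {1..<j} - I" using that by auto
  qed simp
  have inj: "inj_on ?g ?C"
    by (rule linorder_inj_onI') (use less in fastforce)
  have "?g i < n" if "i \<in> ?C" for i
  proof -
    have "?g i < card ?C"
      by (rule psubset_card_mono) (use that in auto)
    then show ?thesis using card by simp
  qed
  then have "?g ` ?C \<subseteq> {..<n}" by auto
  moreover have "card (?g ` ?C) = n" using inj card by (simp add: card_image)
  ultimately have "?g ` ?C = {..<n}" by (intro card_subset_eq) auto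
  with inj show ?thesis by (simp add: bij_betw_def)
qed

lemma phi_nth_inv:
  assumes "I \<subseteq> {1..length w + card I}" "k < length w"
  obtains i where "i \<in> {1..length w + card I} - I" "k = card ({1..<i} - I)"
    "w ! k = phi I w ! (i - 1)"
proof -
  have "k \<in> (\<lambda>i. card ({1..<i} - I)) ` ({1..length w + card I} - I)"
    using phi_gap_bij[OF assms(1)] assms(2) by (simp add: bij_betw_def)
  then obtain i where "i \<in> {1..length w + card I} - I" "k = card ({1..<i} - I)"
    by blast
  then show ?thesis using nth_phi[of i w I] that by auto
qed

lemma phi_positions:
  assumes "phi_valid I w"
  shows "wmax (phi I w) = wmax w + 1"
    and "I = {i \<in> {1..length (phi I w)}. phi I w ! (i - 1) = wmax w + 1}"
proof -
  have sub: "I \<subseteq> {1..length w + card I}" and ne: "I \<noteq> {}"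
    using assms by (auto simp: phi_valid_def)
  have small: "phi I w ! (i - 1) \<le> wmax w" if "i \<in> {1..length w + card I} - I" for i
  proof -
    have "card ({1..<i} - I) < length w"
      using phi_gap_bij[OF sub] that by (auto simp: bij_betw_def)
    then show ?thesis using that nth_phi[of i w I] by (auto intro!: wmax_ge)
  qed
  have big: "phi I w ! (i - 1) = wmax w + 1" if "i \<in> I" for i
    using that sub nth_phi[of i w I] by auto
  show "I = {i \<in> {1..length (phi I w)}. phi I w ! (i - 1) = wmax w + 1}"
    using small big sub by fastforce
  show "wmax (phi I w) = wmax w + 1"
  proof (rule wmax_eqI)
    obtain i where "i \<in> I" using ne by blast
    then have "i - 1 < length (phi I w)" "phi I w ! (i - 1) = wmax w + 1"
      using sub big by fastforce+
    then show "wmax w + 1 \<in> set (phi I w)" by (metis nth_mem)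
  next
    fix x assume "x \<in> set (phi I w)"
    then obtain k where k: "k < length w + card I" "x = phi I w ! k"
      by (auto simp: in_set_conv_nth)
    then have "x = phi I w ! (Suc k - 1)" "Suc k \<in> {1..length w + card I}" by auto
    then show "x \<le> wmax w + 1" using small[of "Suc k"] big[of "Suc k"] by fastforce
  qed
qed

lemma phi_inject:
  assumes "phi_valid I v" "phi_valid J w" "phi I v = phi J w"
  shows "I = J \<and> v = w"
proof
  have "wmax v = wmax w" using phi_positions(1) assms by (metis add_right_cancel)
  then show IJ: "I = J"
    using phi_positions(2)[OF assms(1)] phi_positions(2)[OF assms(2)] assms(3) by simp
  have len: "length v = length w"
    using arg_cong[OF assms(3), of length] IJ by simp
  show "v = w"
  proof (rule nth_equalityI[OF len])
    fix k assume k: "k < length v"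
    have sub: "I \<subseteq> {1..length v + card I}" using assms(1) by (simp add: phi_valid_def)
    obtain i where i: "i \<in> {1..length v + card I} - I" "k = card ({1..<i} - I)"
      "v ! k = phi I v ! (i - 1)"
      using phi_nth_inv[OF sub k] by blast
    then show "v ! k = w ! k"
      using nth_phi[of i w J] assms(3) IJ len by auto
  qed
qed

lemma nth_filter_card:
  assumes "k < length xs" "P (xs ! k)"
  shows "filter P xs ! card {j. j < k \<and> P (xs ! j)} = xs ! k"
proof -
  have "filter P xs = filter P (take k xs) @ xs ! k # filter P (drop (Suc k) xs)"
    by (metis assms filter.simps(2) filter_append id_take_nth_drop)
  moreover have "{j. j < length (take k xs) \<and> P (take k xs ! j)} = {j. j < k \<and> P (xs ! j)}"
    using assms(1) by auto
  then have "length (filter P (take k xs)) = card {j. j < k \<and> P (xs ! j)}"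
    by (simp add: length_filter_conv_card)
  ultimately show ?thesis by (metis nth_append_length)
qed

lemma phi_exists:
  assumes "packed v" "v \<noteq> []"
  shows "\<exists>I v'. phi_valid I v' \<and> v = phi I v'"
proof -
  define m where "m = wmax v"
  define I where "I = Suc ` {j. j < length v \<and> v ! j = m}"
  define v' where "v' = filter (\<lambda>x. x \<noteq> m) v"
  have m: "m \<in> set v" "set v = {1..m}"
    using assms wmax_in by (auto simp: m_def packed_def)
  have "set v' = set v - {m}" unfolding v'_def by auto
  also have "\<dots> = {1..m - 1}" unfolding m(2) by auto
  finally have sv': "set v' = {1..m - 1}" .
  have "1 \<le> m" using m by simp
  then have v': "packed v'" "wmax v' + 1 = m"
    using packed_iff sv' packed_wmax[OF sv'] by auto
  have cI: "card I = length (filter (\<lambda>x. x = m) v)"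
    by (simp add: I_def card_image length_filter_conv_card)
  have len: "length v' + card I = length v"
    using sum_length_filter_compl[of "\<lambda>x. x = m" v] by (simp add: cI v'_def)
  have "I \<noteq> {}" using m(1) by (auto simp: I_def in_set_conv_nth)
  moreover have "I \<subseteq> {1..length v' + card I}" unfolding len by (auto simp: I_def)
  ultimately have "phi_valid I v'" using v' by (simp add: phi_valid_def)
  moreover have "v = phi I v'"
  proof (rule nth_equalityI)
    show "length v = length (phi I v')" by (simp add: len)
    fix k assume k: "k < length v"
    have ph: "phi I v' ! k = (if Suc k \<in> I then m else v' ! card ({1..<Suc k} - I))"
      using nth_phi[of "Suc k" v' I] k v'(2) len by auto
    have iff: "Suc j \<in> I \<longleftrightarrow> v ! j = m" if "j < length v" for j
      using that by (auto simp: I_def)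
    show "v ! k = phi I v' ! k"
    proof (cases "v ! k = m")
      case True then show ?thesis using ph iff k by simp
    next
      case False
      have "{1..<Suc k} - I = Suc ` {j. j < k \<and> v ! j \<noteq> m}"
      proof
        show "{1..<Suc k} - I \<subseteq> Suc ` {j. j < k \<and> v ! j \<noteq> m}"
        proof
          fix i assume i: "i \<in> {1..<Suc k} - I"
          then obtain j where "i = Suc j" "j < k" by (cases i) auto
          then show "i \<in> Suc ` {j. j < k \<and> v ! j \<noteq> m}" using i iff[of j] k by auto
        qed
      qed (use iff k in auto)
      then have "card ({1..<Suc k} - I) = card {j. j < k \<and> v ! j \<noteq> m}"
        by (simp add: card_image)
      then show ?thesis
        using False ph iff[OF k] nth_filter_card[of k v "\<lambda>x. x \<noteq> m"] k by (simp add: v'_def)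
    qed
  qed
  ultimately show ?thesis by blast
qed

lemma red_split_phi:
  assumes "phi_valid I v"
  shows "red_split (phi I v) = (I, v)"
  unfolding red_split_def
proof (rule the_equality)
  fix p assume "case p of (J, w) \<Rightarrow> phi_valid J w \<and> phi I v = phi J w"
  then show "p = (I, v)" using phi_inject[OF assms] by (cases p) auto
qed (use assms in simp)

lemma red_op_phi:
  "phi_valid I v \<Longrightarrow> u \<triangleleft>\<^sub>R phi I v = phi ((\<lambda>i. i + length u) ` I) (u \<odot> v)"
  by (simp add: red_op_def red_split_phi)

lemma phi_valid_shift:
  assumes "phi_valid I v" "packed u"
  shows "phi_valid ((\<lambda>i. i + length u) ` I) (u \<odot> v)"
proof -
  have "card ((\<lambda>i. i + length u) ` I) = card I" by (simp add: card_image inj_on_def)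
  then show ?thesis using assms by (auto simp: phi_valid_def packed_odot)
qed

lemma length_red_op:
  assumes "packed v" "v \<noteq> []"
  shows "length (u \<triangleleft>\<^sub>R v) = length u + length v"
proof -
  obtain I v' where "phi_valid I v'" "v = phi I v'" using phi_exists assms by blast
  moreover have "card ((\<lambda>i. i + length u) ` I) = card I" by (simp add: card_image inj_on_def)
  ultimately show ?thesis by (simp add: red_op_phi)
qed

lemma Nil_red_op:
  assumes "packed v" "v \<noteq> []"
  shows "[] \<triangleleft>\<^sub>R v = v"
proof -
  obtain I v' where "phi_valid I v'" "v = phi I v'" using phi_exists assms by blast
  then show ?thesis by (simp add: red_op_phi)
qed

lemma red_factors_unique:
  assumes "red_factors w u v" "red_factors w a b" "length u = length a"
  shows "u = a \<and> v = b"
proof -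
  have pk: "packed u" "packed v" "v \<noteq> []" "packed a" "packed b" "b \<noteq> []"
    and eq: "u \<triangleleft>\<^sub>R v = a \<triangleleft>\<^sub>R b"
    using assms by (auto simp: red_factors_def)
  obtain I v' where v: "phi_valid I v'" "v = phi I v'" using phi_exists pk by blast
  obtain J b' where b: "phi_valid J b'" "b = phi J b'" using phi_exists pk by blast
  have "(\<lambda>i. i + length u) ` I = (\<lambda>i. i + length a) ` J \<and> u \<odot> v' = a \<odot> b'"
    using phi_inject[OF phi_valid_shift[OF v(1) pk(1)] phi_valid_shift[OF b(1) pk(4)]] v b eq
    by (simp add: red_op_phi)
  moreover from this have "u = a \<and> v' = b'" using odot_inject assms(3) by blast
  moreover have "inj (\<lambda>i. i + length a)" by (simp add: inj_def)
  ultimately show ?thesis using v b by (simp add: inj_image_eq_iff)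
qed

lemma psi_bump_inj: "inj (\<lambda>x::nat. if x \<ge> i then x + 1 else x)"
  by (auto simp: inj_def split: if_splits)

lemma length_psi [simp]: "length (psi i \<alpha> w) = Suc (length w)"
  by (cases \<alpha>) auto

lemma psi_inject:
  assumes "psi_valid i \<alpha> v" "psi_valid j \<beta> w" "psi i \<alpha> v = psi j \<beta> w"
  shows "i = j \<and> \<alpha> = \<beta> \<and> v = w"
proof -
  have mem: "k \<in> set x" if "psi_valid k Bullet x" for k x
    using that by (auto simp: packed_def)
  have nmem: "k \<notin> set (map (\<lambda>x. if x \<ge> k then x + 1 else x) y)" for k :: nat and y
    by auto
  show ?thesis
  proof (cases \<alpha>; cases \<beta>)
    assume "\<alpha> = Circ" "\<beta> = Circ"
    then show ?thesis using assms psi_bump_inj by (auto dest: map_injective)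
  next
    assume ab: "\<alpha> = Circ" "\<beta> = Bullet"
    then have "i = j" "map (\<lambda>x. if x \<ge> i then x + 1 else x) v = w" using assms by auto
    then show ?thesis using mem[of j w] nmem[of i v] ab assms(2) by metis
  next
    assume ab: "\<alpha> = Bullet" "\<beta> = Circ"
    then have "i = j" "map (\<lambda>x. if x \<ge> j then x + 1 else x) w = v" using assms by auto
    then show ?thesis using mem[of i v] nmem[of j w] ab assms(1) by metis
  next
    assume "\<alpha> = Bullet" "\<beta> = Bullet"
    then show ?thesis using assms by simp
  qed
qed

lemma psi_exists:
  assumes "packed v" "v \<noteq> []"
  shows "\<exists>i \<alpha> v'. psi_valid i \<alpha> v' \<and> v = psi i \<alpha> v'"
proof -
  define i where "i = last v"
  define x where "x = butlast v"
  have v: "v = x @ [i]" using assms by (simp add: i_def x_def)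
  have st: "insert i (set x) = {1..wmax v}" using assms(1) v by (simp add: packed_def)
  then have i: "1 \<le> i" "i \<le> wmax v" by auto
  show ?thesis
  proof (cases "i \<in> set x")
    case True
    then have "set x = {1..wmax v}" using st by auto
    then have "packed x" "wmax x = wmax v" using packed_iff packed_wmax by (blast, blast)
    then have "psi_valid i Bullet x" using i by simp
    then show ?thesis using v by (metis psi.simps(2))
  next
    case False
    define y where "y = map (\<lambda>a. if a > i then a - 1 else a) x"
    have sx: "set x = {1..wmax v} - {i}" using st False by auto
    have "set y = {1..wmax v - 1}"
    proof
      show "set y \<subseteq> {1..wmax v - 1}"
        using i by (auto simp: y_def sx)
      show "{1..wmax v - 1} \<subseteq> set y"
      proof
        fix a assume a: "a \<in> {1..wmax v - 1}"
        show "a \<in> set y"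
        proof (cases "a < i")
          case True
          then have "a \<in> set x" using a sx i by simp
          moreover have "a = (if a > i then a - 1 else a)" using True by simp
          ultimately show ?thesis unfolding y_def set_map by (rule rev_image_eqI)
        next
          case False
          then have "Suc a \<in> set x" using a sx by simp arith
          moreover have "a = (if Suc a > i then Suc a - 1 else Suc a)" using False by simp
          ultimately show ?thesis unfolding y_def set_map by (rule rev_image_eqI)
        qed
      qed
    qed
    then have "packed y" "wmax y = wmax v - 1" using packed_iff packed_wmax by (blast, blast)
    then have "psi_valid i Circ y" using i by simp
    moreover have "map (\<lambda>a. if a \<ge> i then a + 1 else a) y = x"
      unfolding y_def map_map by (rule map_idI) (use False in auto)
    then have "v = psi i Circ y" using v by simp
    ultimately show ?thesis by blast
  qed
qed

lemma blue_split_psi: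
  assumes "psi_valid i \<alpha> v"
  shows "blue_split (psi i \<alpha> v) = (i, \<alpha>, v)"
  unfolding blue_split_def
proof (rule the_equality)
  fix p assume "case p of (j, \<beta>, w) \<Rightarrow> psi_valid j \<beta> w \<and> psi i \<alpha> v = psi j \<beta> w"
  then obtain j \<beta> w where p: "p = (j, \<beta>, w)" "psi_valid j \<beta> w" "psi i \<alpha> v = psi j \<beta> w"
    by (cases p) auto
  show "p = (i, \<alpha>, v)" using psi_inject[OF assms p(2,3)] p(1) by simp
qed (use assms in simp)

lemma blue_op_psi: "psi_valid i \<alpha> v \<Longrightarrow> u \<triangleleft>\<^sub>B psi i \<alpha> v = psi (i + wmax u) \<alpha> (v \<odot> u)"
  by (simp add: blue_op_def blue_split_psi)

lemma psi_valid_shift: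
  "psi_valid i \<alpha> v \<Longrightarrow> packed u \<Longrightarrow> psi_valid (i + wmax u) \<alpha> (v \<odot> u)"
  by (cases \<alpha>) (auto simp: packed_odot wmax_odot)

lemma length_blue_op:
  assumes "packed v" "v \<noteq> []"
  shows "length (u \<triangleleft>\<^sub>B v) = length u + length v"
proof -
  obtain i \<alpha> v' where "psi_valid i \<alpha> v'" "v = psi i \<alpha> v'" using psi_exists assms by blast
  then show ?thesis by (simp add: blue_op_psi)
qed

lemma Nil_blue_op:
  assumes "packed v" "v \<noteq> []"
  shows "[] \<triangleleft>\<^sub>B v = v"
proof -
  obtain i \<alpha> v' where "psi_valid i \<alpha> v'" "v = psi i \<alpha> v'" using psi_exists assms by blast
  then show ?thesis by (simp add: blue_op_psi)
qed

lemma blue_factors_unique: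
  assumes "blue_factors w u v" "blue_factors w a b" "length u = length a"
  shows "u = a \<and> v = b"
proof -
  have pk: "packed u" "packed v" "v \<noteq> []" "packed a" "packed b" "b \<noteq> []"
    and eq: "u \<triangleleft>\<^sub>B v = a \<triangleleft>\<^sub>B b"
    using assms by (auto simp: blue_factors_def)
  obtain i \<alpha> v' where v: "psi_valid i \<alpha> v'" "v = psi i \<alpha> v'" using psi_exists pk by blast
  obtain j \<beta> b' where b: "psi_valid j \<beta> b'" "b = psi j \<beta> b'" using psi_exists pk by blast
  have *: "i + wmax u = j + wmax a" "\<alpha> = \<beta>" "v' \<odot> u = b' \<odot> a"
    using psi_inject[OF psi_valid_shift[OF v(1) pk(1)] psi_valid_shift[OF b(1) pk(4)]]
      eq v b by (auto simp: blue_op_psi)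
  have "length v' = length b'" using arg_cong[OF *(3), of length] assms(3) by simp
  then have "v' = b' \<and> u = a" using odot_inject *(3) by blast
  then show ?thesis using * v b by simp
qed

lemma red_factorization_exists:
  assumes "packed w" "w \<noteq> []"
  obtains u v where "red_factorization w = (u, v)" "red_factors w u v"
    "\<And>u' v'. red_factors w u' v' \<Longrightarrow> length u' \<le> length u"
proof -
  let ?P = "\<lambda>(u, v). red_factors w u v"
  have "?P ([], w)" using assms by (simp add: red_factors_def Nil_red_op)
  moreover have "\<forall>p. ?P p \<longrightarrow> length (fst p) < Suc (length w)"
    by (auto simp: red_factors_def length_red_op)
  ultimately obtain p where "?P p" "\<And>q. ?P q \<Longrightarrow> length (fst q) \<le> length (fst p)"
    using ex_has_greatest_nat[of ?P _ "\<lambda>p. length (fst p)"] by blast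
  then obtain u v where *: "red_factors w u v"
    "\<And>u' v'. red_factors w u' v' \<Longrightarrow> length u' \<le> length u"
    by (cases p) (auto split: prod.splits)
  have "red_factorization w = (u, v)"
    unfolding red_factorization_def
  proof (rule the_equality)
    fix q assume "case q of (a, b) \<Rightarrow> red_factors w a b \<and>
      (\<forall>u' v'. red_factors w u' v' \<longrightarrow> length u' \<le> length a)"
    then obtain a b where q: "q = (a, b)" "red_factors w a b"
      "\<And>u' v'. red_factors w u' v' \<Longrightarrow> length u' \<le> length a" by (cases q) auto
    then have "length a = length u" using * by (meson le_antisym)
    then show "q = (u, v)" using red_factors_unique[OF q(2) *(1)] q(1) by simp
  qed (use * in auto)
  then show ?thesis using that * by blast
qed

lemma blue_factorization_exists:
  assumes "packed w" "w \<noteq> []"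
  obtains u v where "blue_factorization w = (u, v)" "blue_factors w u v"
    "\<And>u' v'. blue_factors w u' v' \<Longrightarrow> length u' \<le> length u"
proof -
  let ?P = "\<lambda>(u, v). blue_factors w u v"
  have "?P ([], w)" using assms by (simp add: blue_factors_def Nil_blue_op)
  moreover have "\<forall>p. ?P p \<longrightarrow> length (fst p) < Suc (length w)"
    by (auto simp: blue_factors_def length_blue_op)
  ultimately obtain p where "?P p" "\<And>q. ?P q \<Longrightarrow> length (fst q) \<le> length (fst p)"
    using ex_has_greatest_nat[of ?P _ "\<lambda>p. length (fst p)"] by blast
  then obtain u v where *: "blue_factors w u v"
    "\<And>u' v'. blue_factors w u' v' \<Longrightarrow> length u' \<le> length u"
    by (cases p) (auto split: prod.splits)
  have "blue_factorization w = (u, v)"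
    unfolding blue_factorization_def
  proof (rule the_equality)
    fix q assume "case q of (a, b) \<Rightarrow> blue_factors w a b \<and>
      (\<forall>u' v'. blue_factors w u' v' \<longrightarrow> length u' \<le> length a)"
    then obtain a b where q: "q = (a, b)" "blue_factors w a b"
      "\<And>u' v'. blue_factors w u' v' \<Longrightarrow> length u' \<le> length a" by (cases q) auto
    then have "length a = length u" using * by (meson le_antisym)
    then show "q = (u, v)" using blue_factors_unique[OF q(2) *(1)] q(1) by simp
  qed (use * in auto)
  then show ?thesis using that * by blast
qed

lemma red_factorization_length:
  assumes "packed w" "w \<noteq> []" "red_factorization w = (u, v)"
  shows "packed u" "packed v" "v \<noteq> []" "length u < length w" "length v \<le> length w"
proof -
  have "red_factors w u v" using red_factorization_exists assms by (metis Pair_inject)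
  then show "packed u" "packed v" "v \<noteq> []" "length u < length w" "length v \<le> length w"
    by (auto simp: red_factors_def length_red_op)
qed

lemma blue_factorization_length:
  assumes "packed w" "w \<noteq> []" "blue_factorization w = (u, v)"
  shows "packed u" "packed v" "v \<noteq> []" "length u < length w" "length v \<le> length w"
proof -
  have "blue_factors w u v" using blue_factorization_exists assms by (metis Pair_inject)
  then show "packed u" "packed v" "v \<noteq> []" "length u < length w" "length v \<le> length w"
    by (auto simp: blue_factors_def length_blue_op)
qed

lemma odot_list_simps [simp]:
  "odot_list [] = []" "odot_list (x # xs) = x \<odot> odot_list xs"
  by (simp_all add: odot_list_def)

lemma packed_odot_list: "\<forall>x \<in> set ws. packed x \<Longrightarrow> packed (odot_list ws)"
  by (induction ws) (auto simp: packed_odot)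

lemma global_descent_odot:
  assumes "packed u" "u \<noteq> []" "v \<noteq> []"
  shows "global_descent (u \<odot> v) (length u)"
proof -
  have "y < x + wmax v" if "x \<in> set u" "y \<in> set v" for x y
  proof -
    have "1 \<le> x" using that(1) assms(1) by (auto simp: packed_def)
    then show ?thesis using wmax_ge[OF that(2)] by simp
  qed
  then show ?thesis
    using assms(2,3) by (auto simp: global_descent_def odot_def shift_def Suc_le_eq)
qed

lemma global_descent_prefix:
  assumes "global_descent (u \<odot> v) c" "c < length u"
  shows "global_descent u c"
proof -
  have "y < x" if "x \<in> set (take c u)" "y \<in> set (drop c u)" for x y
  proof -
    have "x + wmax v \<in> set (take c (u \<odot> v))" "y + wmax v \<in> set (drop c (u \<odot> v))"
      using that assms(2) by (auto simp: odot_def shift_def take_map drop_map)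
    then have "y + wmax v < x + wmax v" using assms(1) unfolding global_descent_def by blast
    then show ?thesis by simp
  qed
  then show ?thesis using assms by (auto simp: global_descent_def)
qed

lemma irreducible_decomposition_unique:
  assumes "\<forall>x \<in> set xs. irreducible_word x" "\<forall>x \<in> set ys. irreducible_word x"
    "odot_list xs = odot_list ys"
  shows "xs = ys"
  using assms
proof (induction xs arbitrary: ys)
  case Nil
  then show ?case by (cases ys) (auto simp: irreducible_word_def odot_def shift_def)
next
  case (Cons x xs)
  then obtain y ys' where ys: "ys = y # ys'"
    by (cases ys) (auto simp: irreducible_word_def odot_def shift_def)
  have eq: "x \<odot> odot_list xs = y \<odot> odot_list ys'" using Cons.prems ys by simp
  have irr: "irreducible_word x" "irreducible_word y" using Cons.prems ys by auto
  have no: False if "irreducible_word a" "irreducible_word b" "length a < length b"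
    "a \<odot> r = b \<odot> s" for a b r s
  proof -
    have "r \<noteq> []" using arg_cong[OF that(4), of length] that(3) by auto
    then have "global_descent (b \<odot> s) (length a)"
      using global_descent_odot[of a r] that by (auto simp: irreducible_word_def)
    then show False
      using global_descent_prefix[of b s "length a"] that by (auto simp: irreducible_word_def)
  qed
  have "length x = length y"
    using no[OF irr _ eq] no[OF irr(2,1) _ eq[symmetric]] by (metis linorder_neqE_nat)
  then have *: "x = y" "odot_list xs = odot_list ys'" using odot_inject[OF eq] by auto
  have "xs = ys'"
    by (rule Cons.IH[OF _ _ *(2)]) (use Cons.prems(1,2) ys in auto)
  then show ?case using *(1) ys by simp
qed

lemma global_descent_split:
  assumes "packed w" "global_descent w c"
  shows "\<exists>u v. packed u \<and> packed v \<and> u \<noteq> [] \<and> v \<noteq> [] \<and> w = u \<odot> v"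
proof -
  define v where "v = drop c w"
  define m where "m = wmax v"
  define u where "u = map (\<lambda>x. x - m) (take c w)"
  have c: "1 \<le> c" "c < length w" and gt: "\<And>x y. x \<in> set (take c w) \<Longrightarrow> y \<in> set v \<Longrightarrow> y < x"
    using assms(2) by (auto simp: global_descent_def v_def)
  have ne: "u \<noteq> []" "v \<noteq> []" using c by (auto simp: u_def v_def)
  have un: "set (take c w) \<union> set v = {1..wmax w}"
    using assms(1) by (metis append_take_drop_id packed_def set_append v_def)
  have mv: "m \<in> set v" using ne wmax_in by (simp add: m_def)
  have gm: "m < x" if "x \<in> set (take c w)" for x using gt that mv by blast
  have lm: "x \<le> m" if "x \<in> set v" for x using that wmax_ge by (simp add: m_def)
  have "m \<le> wmax w" using un mv by auto
  then have sv: "set v = {1..m}"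
  proof (intro set_eqI iffI)
    fix x assume "x \<in> set v"
    then show "x \<in> {1..m}" using un lm by fastforce
  next
    fix x assume x: "x \<in> {1..m}"
    then have "x \<in> set (take c w) \<union> set v" unfolding un using \<open>m \<le> wmax w\<close> by simp
    moreover have "x \<notin> set (take c w)" using gm[of x] x by auto
    ultimately show "x \<in> set v" by blast
  qed
  have st: "set (take c w) = {m + 1..wmax w}"
  proof (intro set_eqI iffI)
    fix x assume "x \<in> set (take c w)"
    then have "m < x" "x \<in> {1..wmax w}" using gm un by blast+
    then show "x \<in> {m + 1..wmax w}" by simp
  next
    fix x assume x: "x \<in> {m + 1..wmax w}"
    then have "x \<in> set (take c w) \<union> set v" unfolding un by simp
    then show "x \<in> set (take c w)" using x sv by simp
  qed
  have "set u = {1..wmax w - m}"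
  proof -
    have *: "{m + 1..wmax w} = (\<lambda>x. x + m) ` {1..wmax w - m}"
      using \<open>m \<le> wmax w\<close> by (simp add: image_add_atLeastAtMost')
    have "set u = (\<lambda>x. x - m) ` (\<lambda>x. x + m) ` {1..wmax w - m}"
      unfolding u_def set_map st * ..
    then show ?thesis unfolding image_image by simp
  qed
  moreover have "shift m u = take c w"
    unfolding u_def shift_def map_map by (rule map_idI) (use gm in fastforce)
  then have "w = u \<odot> v" by (simp add: odot_def m_def[symmetric]) (simp add: v_def)
  ultimately show ?thesis using ne sv packed_iff by blast
qed

lemma odot_assoc:
  assumes "packed u" "packed v" "packed w"
  shows "(u \<odot> v) \<odot> w = u \<odot> (v \<odot> w)"
  using wmax_odot[OF assms(2,3)] by (simp add: odot_def shift_def add_ac)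

lemma odot_list_append:
  assumes "\<forall>x \<in> set xs. packed x" "\<forall>x \<in> set ys. packed x"
  shows "odot_list (xs @ ys) = odot_list xs \<odot> odot_list ys"
  using assms by (induction xs) (auto simp: odot_assoc packed_odot_list)

lemma irreducible_decomposition_exists:
  "packed w \<Longrightarrow> \<exists>ws. (\<forall>x \<in> set ws. irreducible_word x) \<and> odot_list ws = w"
proof (induction w rule: length_induct)
  case (1 w)
  consider "w = []" | "irreducible_word w" | c where "global_descent w c"
    using 1(2) by (auto simp: irreducible_word_def)
  then show ?case
  proof cases
    case 1
    then show ?thesis by (intro exI[of _ "[]"]) simp
  next
    case 2
    then show ?thesis by (intro exI[of _ "[w]"]) simp
  next
    case 3
    then obtain u v where uv: "packed u" "packed v" "u \<noteq> []" "v \<noteq> []" "w = u \<odot> v"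
      using global_descent_split 1(2) by blast
    then have "length u < length w" "length v < length w" by auto
    then obtain us vs where "\<forall>x \<in> set us. irreducible_word x" "odot_list us = u"
      "\<forall>x \<in> set vs. irreducible_word x" "odot_list vs = v"
      using 1(1) uv by metis
    then show ?thesis
      using uv by (intro exI[of _ "us @ vs"]) (auto simp: odot_list_append irreducible_word_def)
  qed
qed

lemma irreducible_decomposition:
  assumes "packed w"
  shows "\<forall>x \<in> set (irreducible_decomposition w). irreducible_word x"
    and "odot_list (irreducible_decomposition w) = w"
proof -
  have "\<exists>!ws. (\<forall>x \<in> set ws. irreducible_word x) \<and> odot_list ws = w"
    using irreducible_decomposition_exists[OF assms] irreducible_decomposition_unique by blast
  from theI'[OF this] show "\<forall>x \<in> set (irreducible_decomposition w). irreducible_word x"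
    and "odot_list (irreducible_decomposition w) = w"
    by (simp_all add: irreducible_decomposition_def)
qed

lemma length_odot_list_mem: "x \<in> set ws \<Longrightarrow> length x \<le> length (odot_list ws)"
  by (induction ws) auto

lemma irreducible_decomposition_length:
  "packed w \<Longrightarrow> x \<in> set (irreducible_decomposition w) \<Longrightarrow> length x \<le> length w"
  using irreducible_decomposition length_odot_list_mem by metis


subsection \<open>The maps between words and forests\<close>

text \<open>The values outside packed, respectively irreducible, words are irrelevant.\<close>

function (sequential) F_RB :: "word \<Rightarrow> word biplane_forest"
  and T_RB :: "word \<Rightarrow> word biplane_tree" where
  "F_RB w = (if packed w then map T_RB (irreducible_decomposition w) else undefined)"
| "T_RB w = (if irreducible_word w then
     (case red_factorization w of (a, x) \<Rightarrow>
       (case blue_factorization x of (b, c) \<Rightarrow> Node c (F_RB a) (F_RB b)))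
     else undefined)"
  by pat_completeness auto
termination
proof (relation "measure (\<lambda>x. case x of Inl w \<Rightarrow> 2 * length w + 1 | Inr w \<Rightarrow> 2 * length w)",
    goal_cases)
  case (2 w x)
  then show ?case using irreducible_decomposition_length by fastforce
next
  case (3 w a x b c)
  then show ?case
    using red_factorization_length(4)[of w a x] by (auto simp: irreducible_word_def)
next
  case (4 w a x b c)
  then show ?case
    using red_factorization_length[of w a x] blue_factorization_length(4)[of x b c]
    by (auto simp: irreducible_word_def)
qed simp

function (sequential) F_BR :: "word \<Rightarrow> word biplane_forest"
  and T_BR :: "word \<Rightarrow> word biplane_tree" where
  "F_BR w = (if packed w then map T_BR (rev (irreducible_decomposition w)) else undefined)"
| "T_BR w = (if irreducible_word w then
     (case blue_factorization w of (b, y) \<Rightarrow>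
       (case red_factorization y of (a, c) \<Rightarrow> Node c (F_BR b) (F_BR a)))
     else undefined)"
  by pat_completeness auto
termination
proof (relation "measure (\<lambda>x. case x of Inl w \<Rightarrow> 2 * length w + 1 | Inr w \<Rightarrow> 2 * length w)",
    goal_cases)
  case (2 w x)
  then show ?case using irreducible_decomposition_length by fastforce
next
  case (3 w b y a c)
  then show ?case
    using blue_factorization_length(4)[of w b y] by (auto simp: irreducible_word_def)
next
  case (4 w b y a c)
  then show ?case
    using blue_factorization_length[of w b y] red_factorization_length(4)[of y a c]
    by (auto simp: irreducible_word_def)
qed simp

text \<open>The unconditional equations would make the simplifier loop.\<close>

declare F_RB.simps [simp del] T_RB.simps [simp del] F_BR.simps [simp del] T_BR.simps [simp del]

fun F_RB_star :: "word biplane_forest \<Rightarrow> word"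
  and T_RB_star :: "word biplane_tree \<Rightarrow> word" where
  "F_RB_star [] = []"
| "F_RB_star (t # ts) = T_RB_star t \<odot> F_RB_star ts"
| "T_RB_star (Node c fl fr) = F_RB_star fl \<triangleleft>\<^sub>R (F_RB_star fr \<triangleleft>\<^sub>B c)"

end

theory Submission
  imports Defs
begin

text \<open>
  Both operations have closed forms: \<open>u \<triangleleft>\<^sub>R v\<close> is a raised copy of \<open>u\<close> followed by \<open>v\<close> with its maximal
  letters raised above that copy, and \<open>u \<triangleleft>\<^sub>B v\<close> inserts \<open>u\<close> just before the last letter of a raised
  \<open>v\<close>.  Hence factorizations of \<open>w\<close> are cuts of \<open>w\<close> at a position, the cuts of \<open>u \<triangleleft> v\<close> at or beyond
  \<open>u\<close> are those of \<open>v\<close>, and the maximal factorization is the unique one with an irreducible second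
  factor.  The two colors do not interfere: for irreducible \<open>c \<noteq> 1\<close> the word \<open>b \<triangleleft>\<^sub>B c\<close> is
  red-irreducible iff \<open>c\<close> is (and symmetrically), while \<open>b \<triangleleft>\<^sub>B 1 = b \<triangleleft>\<^sub>R 1\<close> forces \<open>b = \<epsilon>\<close>, which
  explains the special role of the label \<open>1\<close>.  The bijections follow by induction on lengths and trees.
\<close>

section \<open>Explicit form of the two operations\<close>

lemma wmax_packed_pos: "packed v \<Longrightarrow> v \<noteq> [] \<Longrightarrow> 1 \<le> wmax v"
  using wmax_in[of v] by (auto simp: packed_def)

lemma packed_letter_pos: "packed v \<Longrightarrow> x \<in> set v \<Longrightarrow> 1 \<le> x"
  by (auto simp: packed_def)

lemma red_op_explicit:
  assumes u: "packed u" and v: "packed v" "v \<noteq> []"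
  shows "u \<triangleleft>\<^sub>R v =
    shift (wmax v - 1) u @ map (\<lambda>x. if x = wmax v then x + wmax u else x) v"
proof -
  obtain I v' where val: "phi_valid I v'" and veq: "v = phi I v'"
    using phi_exists v by blast
  define J where "J = (\<lambda>i. i + length u) ` I"
  have op: "u \<triangleleft>\<^sub>R v = phi J (u \<odot> v')" using val veq red_op_phi J_def by simp
  have cJ: "card J = card I" by (simp add: J_def card_image inj_on_def)
  have sub: "I \<subseteq> {1..length v' + card I}" and pv': "packed v'"
    using val by (auto simp: phi_valid_def)
  have lv: "length v = length v' + card I" using veq by simp
  have wv: "wmax v = wmax v' + 1" using phi_positions(1)[OF val] veq by simp
  have wuv: "wmax (u \<odot> v') = wmax u + wmax v'" using wmax_odot[OF u pv'] .
  have J_gt: "length u < i" if "i \<in> J" for i using that sub by (auto simp: J_def)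
  show ?thesis unfolding op
  proof (rule nth_equalityI)
    show "length (phi J (u \<odot> v')) = length (shift (wmax v - 1) u @
        map (\<lambda>x. if x = wmax v then x + wmax u else x) v)"
      by (simp add: cJ lv shift_def)
  next
    fix k assume "k < length (phi J (u \<odot> v'))"
    then have k: "k < length u + length v" by (simp add: cJ lv)
    have ph: "phi J (u \<odot> v') ! k = (if Suc k \<in> J then wmax u + wmax v' + 1
        else (u \<odot> v') ! card ({1..<Suc k} - J))"
      using nth_phi[of "Suc k" "u \<odot> v'" J] k by (simp add: cJ lv wuv)
    show "phi J (u \<odot> v') ! k = (shift (wmax v - 1) u @
        map (\<lambda>x. if x = wmax v then x + wmax u else x) v) ! k"
    proof (cases "k < length u")
      case True
      then have "Suc k \<notin> J" "{1..<Suc k} - J = {1..<Suc k}" using J_gt by fastforce+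
      then show ?thesis using ph True by (simp add: odot_def shift_def nth_append wv)
    next
      case False
      define j where "j = k - length u"
      have j: "k = length u + j" "j < length v" using False k by (auto simp: j_def)
      have mem: "Suc k \<in> J \<longleftrightarrow> Suc j \<in> I" using j by (auto simp: J_def)
      have vj: "v ! j = (if Suc j \<in> I then wmax v' + 1 else v' ! card ({1..<Suc j} - I))"
        using nth_phi[of "Suc j" v' I] j(2) by (simp add: veq)
      show ?thesis
      proof (cases "Suc j \<in> I")
        case True
        then show ?thesis using ph mem vj j by (simp add: nth_append shift_def wv)
      next
        case False
        have "{1..<Suc k} - J = {1..length u} \<union> (\<lambda>i. i + length u) ` ({1..<Suc j} - I)"
        proof (intro set_eqI iffI)
          fix i assume i: "i \<in> {1..<Suc k} - J"
          show "i \<in> {1..length u} \<union> (\<lambda>i. i + length u) ` ({1..<Suc j} - I)"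
          proof (cases "i \<le> length u")
            case False
            then have "i = (i - length u) + length u" "i - length u \<in> {1..<Suc j} - I"
              using i j by (auto simp: J_def image_iff)
            then show ?thesis by blast
          qed (use i in auto)
        next
          fix i assume "i \<in> {1..length u} \<union> (\<lambda>i. i + length u) ` ({1..<Suc j} - I)"
          then show "i \<in> {1..<Suc k} - J" using J_gt j by (fastforce simp: J_def)
        qed
        moreover have "card ({1..length u} \<union> (\<lambda>i. i + length u) ` ({1..<Suc j} - I))
          = length u + card ({1..<Suc j} - I)"
          by (subst card_Un_disjoint) (auto simp: card_image inj_on_def)
        ultimately have c: "card ({1..<Suc k} - J) = length u + card ({1..<Suc j} - I)"
          by simp
        have "Suc j \<in> {1..length v' + card I} - I" using False j lv by simp
        then have "card ({1..<Suc j} - I) < length v'"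
          using phi_gap_bij[OF sub] by (auto simp: bij_betw_def)
        moreover from this have "v ! j \<le> wmax v'" using vj False by (auto intro!: wmax_ge)
        ultimately show ?thesis
          using ph mem vj False j c by (simp add: odot_def nth_append shift_def wv)
      qed
    qed
  qed
qed

lemma blue_op_explicit:
  assumes "packed v" "v \<noteq> []"
  shows "u \<triangleleft>\<^sub>B v = shift (wmax u) (butlast v) @ u @ [last v + wmax u]"
proof -
  obtain i \<alpha> v' where val: "psi_valid i \<alpha> v'" and v: "v = psi i \<alpha> v'"
    using psi_exists assms by blast
  have "x < i + wmax u" if "x \<in> set u" for x
    using wmax_ge[OF that] val by (cases \<alpha>) auto
  then have "map (\<lambda>x. if i + wmax u \<le> x then x + 1 else x) u = u"
    by (intro map_idI) fastforce
  then show ?thesis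
    unfolding v blue_op_psi[OF val] by (cases \<alpha>) (simp_all add: odot_def shift_def)
qed

lemma set_red_op:
  assumes "packed u" "packed v" "v \<noteq> []"
  shows "set (u \<triangleleft>\<^sub>R v) = {1..wmax u + wmax v}"
proof -
  define m where "m = wmax v - 1"
  have m: "wmax v = m + 1" using wmax_packed_pos[OF assms(2,3)] by (simp add: m_def)
  have su: "set u = {1..wmax u}" and sv: "set v = {1..m + 1}"
    using assms m by (auto simp: packed_def)
  have "set (shift m u) = {1 + m..wmax u + m}"
    unfolding shift_def set_map su by (simp add: image_add_atLeastAtMost')
  moreover have "set (map (\<lambda>x. if x = m + 1 then x + wmax u else x) v)
      = insert (m + 1 + wmax u) {1..m}"
    unfolding set_map sv by (auto simp: image_iff)
  ultimately show ?thesis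
    unfolding red_op_explicit[OF assms] m by auto
qed

lemma set_blue_op:
  assumes "packed u" "packed v" "v \<noteq> []"
  shows "set (u \<triangleleft>\<^sub>B v) = {1..wmax u + wmax v}"
proof -
  have "set (butlast v) \<union> {last v} = set v"
    using assms(3) by (cases v rule: rev_cases) auto
  then have "set (shift (wmax u) (butlast v)) \<union> {last v + wmax u} = (\<lambda>x. x + wmax u) ` set v"
    by (auto simp: shift_def)
  also have "\<dots> = {1 + wmax u..wmax v + wmax u}"
    using assms(2) unfolding packed_def by (metis image_add_atLeastAtMost')
  finally have "set (u \<triangleleft>\<^sub>B v) = {1 + wmax u..wmax v + wmax u} \<union> set u"
    unfolding blue_op_explicit[OF assms(2,3)] by auto
  then show ?thesis using assms(1) by (auto simp: packed_def)
qed

lemma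
  assumes "packed u" "packed v" "v \<noteq> []"
  shows packed_red_op: "packed (u \<triangleleft>\<^sub>R v)"
    and wmax_red_op: "wmax (u \<triangleleft>\<^sub>R v) = wmax u + wmax v"
    and packed_blue_op: "packed (u \<triangleleft>\<^sub>B v)"
    and wmax_blue_op: "wmax (u \<triangleleft>\<^sub>B v) = wmax u + wmax v"
  using set_red_op[OF assms] set_blue_op[OF assms] packed_iff packed_wmax by blast+

lemma irreducible_red_op:
  assumes "packed u" "irreducible_word v"
  shows "irreducible_word (u \<triangleleft>\<^sub>R v)"
proof -
  have v: "packed v" "v \<noteq> []" using assms(2) by (auto simp: irreducible_word_def)
  define m where "m = wmax v"
  have ex: "u \<triangleleft>\<^sub>R v = shift (m - 1) u @ map (\<lambda>x. if x = m then x + wmax u else x) v"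
    using red_op_explicit[OF assms(1) v] by (simp add: m_def)
  have mv: "m \<in> set v" using wmax_in v by (simp add: m_def)
  have le: "x \<le> m" if "x \<in> set v" for x using wmax_ge[OF that] by (simp add: m_def)
  have ule: "x + (m - 1) < m + wmax u" if "x \<in> set u" for x
    using wmax_ge[OF that] wmax_packed_pos[OF v] by (simp add: m_def)
  have "\<not> global_descent (u \<triangleleft>\<^sub>R v) c" for c
  proof
    assume gd: "global_descent (u \<triangleleft>\<^sub>R v) c"
    then have c: "1 \<le> c" "c < length u + length v"
      and gt: "\<And>x y. x \<in> set (take c (u \<triangleleft>\<^sub>R v)) \<Longrightarrow> y \<in> set (drop c (u \<triangleleft>\<^sub>R v)) \<Longrightarrow> y < x"
      by (auto simp: global_descent_def length_red_op[OF v])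
    show False
    proof (cases "c \<le> length u")
      case True
      then obtain x where x: "x \<in> set (take c u)"
        using c by (metis gr_zeroI length_greater_0_conv length_take min.absorb2 not_one_le_zero
            nth_mem)
      then have "x + (m - 1) \<in> set (take c (u \<triangleleft>\<^sub>R v))"
        using True by (auto simp: ex shift_def take_map)
      moreover have "m + wmax u \<in> set (drop c (u \<triangleleft>\<^sub>R v))"
        using True mv by (auto simp: ex shift_def image_iff)
      ultimately have "m + wmax u < x + (m - 1)" using gt by blast
      moreover have "x + (m - 1) < m + wmax u" using ule x in_set_takeD by fast
      ultimately show False by simp
    next
      case False
      define d where "d = c - length u"
      have d: "c = length u + d" "1 \<le> d" "d < length v" using False c by (auto simp: d_def)
      have "y < x" if xy: "x \<in> set (take d v)" "y \<in> set (drop d v)" for x y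
      proof -
        let ?f = "\<lambda>x. if x = m then x + wmax u else x"
        have "?f x \<in> set (take c (u \<triangleleft>\<^sub>R v))" "?f y \<in> set (drop c (u \<triangleleft>\<^sub>R v))"
          using xy d by (auto simp: ex shift_def take_map drop_map)
        then have "?f y < ?f x" using gt by blast
        then show ?thesis
          using le[of x] le[of y] xy in_set_takeD[of x d v] in_set_dropD[of y d v]
          by (auto split: if_splits)
      qed
      then have "global_descent v d" using d by (simp add: global_descent_def)
      then show False using assms(2) by (auto simp: irreducible_word_def)
    qed
  qed
  then show ?thesis
    using packed_red_op[OF assms(1) v] length_red_op[OF v, of u] v
    by (fastforce simp: irreducible_word_def)
qed

lemma irreducible_blue_op:
  assumes "packed u" "irreducible_word v"
  shows "irreducible_word (u \<triangleleft>\<^sub>B v)"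
proof -
  have v: "packed v" "v \<noteq> []" using assms(2) by (auto simp: irreducible_word_def)
  define v' l where "v' = butlast v" and "l = last v"
  have veq: "v = v' @ [l]" using v by (simp add: v'_def l_def)
  have ex: "u \<triangleleft>\<^sub>B v = shift (wmax u) v' @ u @ [l + wmax u]"
    using blue_op_explicit[OF v] by (simp add: v'_def l_def)
  have "\<not> global_descent (u \<triangleleft>\<^sub>B v) c" for c
  proof
    assume gd: "global_descent (u \<triangleleft>\<^sub>B v) c"
    then have c: "1 \<le> c" "c < length u + length v"
      and gt: "\<And>x y. x \<in> set (take c (u \<triangleleft>\<^sub>B v)) \<Longrightarrow> y \<in> set (drop c (u \<triangleleft>\<^sub>B v)) \<Longrightarrow> y < x"
      by (auto simp: global_descent_def length_blue_op[OF v])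
    show False
    proof (cases "c \<le> length v'")
      case False
      then obtain h t where u: "u = h # t" using c by (cases u) (auto simp: veq)
      obtain d where d: "c = length v' + Suc d"
        using False by (metis not_le less_iff_Suc_add add_Suc_right)
      then have "h \<in> set (take c (u \<triangleleft>\<^sub>B v))"
        unfolding ex by (simp add: shift_def u)
      moreover have "l + wmax u \<in> set (drop c (u \<triangleleft>\<^sub>B v))"
        using c d unfolding ex by (simp add: shift_def u veq)
      ultimately have "l + wmax u < h" using gt by blast
      then show False using wmax_ge[of h u] u by simp
    next
      case True
      have "y < x" if xy: "x \<in> set (take c v)" "y \<in> set (drop c v)" for x y
      proof -
        have "x + wmax u \<in> set (take c (u \<triangleleft>\<^sub>B v))" "y + wmax u \<in> set (drop c (u \<triangleleft>\<^sub>B v))"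
          using xy True unfolding ex by (auto simp: shift_def veq take_map drop_map)
        then show ?thesis using gt by fastforce
      qed
      then have "global_descent v c" using c True by (simp add: global_descent_def veq)
      then show False using assms(2) by (auto simp: irreducible_word_def)
    qed
  qed
  then show ?thesis
    using packed_blue_op[OF assms(1) v] length_blue_op[OF v, of u] v
    by (fastforce simp: irreducible_word_def)
qed

section \<open>Factorizations as cuts\<close>

lemma initial_segment_split:
  fixes A B :: "nat set"
  assumes un: "A \<union> B = {1..N}" and gt: "\<And>x y. x \<in> A \<Longrightarrow> y \<in> B \<Longrightarrow> y < x"
  obtains m where "m \<le> N" "B = {1..m}" "A = {m + 1..N}"
proof (cases "B = {}")
  case True
  then show ?thesis using un that[of 0] by simp
next
  case False
  have fin: "finite B" using un by (metis finite_Un finite_atLeastAtMost)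
  define m where "m = Max B"
  have m: "m \<in> B" "\<And>y. y \<in> B \<Longrightarrow> y \<le> m" using False fin by (auto simp: m_def)
  have "m \<le> N" using m(1) un by auto
  moreover have "B = {1..m}"
  proof (intro set_eqI iffI)
    fix y assume y: "y \<in> {1..m}"
    then have "y \<in> A \<union> B" using \<open>m \<le> N\<close> unfolding un by simp
    then show "y \<in> B" using gt[OF _ m(1), of y] y by auto
  qed (use m un in auto)
  moreover have "A = {m + 1..N}"
  proof (intro set_eqI iffI)
    fix y assume "y \<in> A"
    then have "m < y" "y \<in> {1..N}" using gt m(1) un by blast+
    then show "y \<in> {m + 1..N}" by simp
  next
    fix y assume y: "y \<in> {m + 1..N}"
    then have "y \<in> A \<union> B" unfolding un by simp
    then show "y \<in> A" using m(2)[of y] y by auto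
  qed
  ultimately show ?thesis by (rule that)
qed

text \<open>
  The red factors \<open>(u, v)\<close> of a packed word correspond to the places \<open>k = |u|\<close> where the prefix
  dominates all of the remaining letters except the maximal ones.
\<close>

definition red_cut :: "word \<Rightarrow> nat \<Rightarrow> bool" where
  "red_cut w k \<longleftrightarrow> k < length w \<and> wmax w \<notin> set (take k w) \<and>
     (\<forall>x \<in> set (take k w). \<forall>y \<in> set (drop k w). y < x \<or> y = wmax w)"

text \<open>
  The blue factors \<open>(u, v)\<close> correspond to the places \<open>j = |v| - 1\<close> such that the letters after \<open>j\<close>
  and before the last one are below all other letters.
\<close>

definition blue_cut :: "word \<Rightarrow> nat \<Rightarrow> bool" where
  "blue_cut w j \<longleftrightarrow> j < length w \<and>
     (\<forall>x \<in> set (drop j (butlast w)). x < last w \<and> (\<forall>y \<in> set (take j w). x < y))"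

lemma red_cut_0: "w \<noteq> [] \<Longrightarrow> red_cut w 0"
  by (simp add: red_cut_def)

lemma blue_cut_last: "w \<noteq> [] \<Longrightarrow> blue_cut w (length w - 1)"
  by (simp add: blue_cut_def)

lemma red_cut_red_op:
  assumes "packed u" "packed v" "v \<noteq> []"
  shows "red_cut (u \<triangleleft>\<^sub>R v) (length u + k) \<longleftrightarrow> red_cut v k"
proof -
  define m where "m = wmax v"
  define f where "f = (\<lambda>x. if x = m then x + wmax u else x)"
  have ex: "u \<triangleleft>\<^sub>R v = shift (m - 1) u @ map f v"
    using red_op_explicit[OF assms] by (simp add: m_def f_def)
  have wm: "wmax (u \<triangleleft>\<^sub>R v) = f m"
    using wmax_red_op[OF assms] by (simp add: m_def f_def)
  have m1: "1 \<le> m" using wmax_packed_pos assms by (simp add: m_def)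
  have le: "x \<le> m" if "x \<in> set v" for x using wmax_ge[OF that] by (simp add: m_def)
  have f_less: "f y < f x \<longleftrightarrow> y < x" if "x \<in> set v" "y \<in> set v" for x y
    using le[OF that(1)] le[OF that(2)] by (auto simp: f_def)
  have f_eq: "f x = f m \<longleftrightarrow> x = m" if "x \<in> set v" for x
    using le[OF that] by (auto simp: f_def)
  have u_ne: "x + (m - 1) \<noteq> f m" if "x \<in> set u" for x
    using wmax_ge[OF that] m1 by (auto simp: f_def)
  have u_gt: "f y < x + (m - 1) \<or> f y = f m" if "x \<in> set u" "y \<in> set v" for x y
    using packed_letter_pos[OF assms(1) that(1)] le[OF that(2)] by (auto simp: f_def)
  have tk: "set (take (length u + k) (u \<triangleleft>\<^sub>R v)) =
      (\<lambda>x. x + (m - 1)) ` set u \<union> f ` set (take k v)"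
    and dr: "set (drop (length u + k) (u \<triangleleft>\<^sub>R v)) = f ` set (drop k v)"
    by (simp_all add: ex shift_def take_map drop_map)
  have tv: "\<And>x. x \<in> set (take k v) \<Longrightarrow> x \<in> set v"
    and dv: "\<And>x. x \<in> set (drop k v) \<Longrightarrow> x \<in> set v"
    by (auto dest: in_set_takeD in_set_dropD)
  have e: "f y < f x \<or> f y = f m \<longleftrightarrow> y < x \<or> y = m"
    if "x \<in> set (take k v)" "y \<in> set (drop k v)" for x y
    using f_less[OF tv dv] f_eq[OF dv] that by simp
  have "f m \<notin> set (take (length u + k) (u \<triangleleft>\<^sub>R v)) \<longleftrightarrow> m \<notin> set (take k v)"
    unfolding tk using u_ne f_eq tv by fastforce
  moreover have "(\<forall>x \<in> set (take (length u + k) (u \<triangleleft>\<^sub>R v)).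
        \<forall>y \<in> set (drop (length u + k) (u \<triangleleft>\<^sub>R v)). y < x \<or> y = f m) \<longleftrightarrow>
      (\<forall>x \<in> set (take k v). \<forall>y \<in> set (drop k v). y < x \<or> y = m)"
    unfolding tk dr ball_Un ball_simps using u_gt dv by (simp add: e cong: ball_cong)
  ultimately show ?thesis
    unfolding red_cut_def wm m_def[symmetric] length_red_op[OF assms(2,3)] by simp
qed

lemma blue_cut_blue_op:
  assumes "packed u" "packed v" "v \<noteq> []" "j < length v"
  shows "blue_cut (u \<triangleleft>\<^sub>B v) j \<longleftrightarrow> blue_cut v j"
proof -
  define v' l where "v' = butlast v" and "l = last v"
  have veq: "v = v' @ [l]" using assms by (simp add: v'_def l_def)
  have j: "j \<le> length v'" using assms(4) by (simp add: veq)
  have ex: "u \<triangleleft>\<^sub>B v = (shift (wmax u) v' @ u) @ [l + wmax u]"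
    using blue_op_explicit[OF assms(2,3)] by (simp add: v'_def l_def)
  have less: "x < y + wmax u" if "x \<in> set u" "y \<in> set v" for x y
    using wmax_ge[OF that(1)] packed_letter_pos[OF assms(2) that(2)] by simp
  have tv: "\<And>x. x \<in> set (take j v') \<Longrightarrow> x \<in> set v" and lv: "l \<in> set v"
    by (auto simp: veq dest: in_set_takeD)
  have "set (drop j (butlast (u \<triangleleft>\<^sub>B v))) = (\<lambda>x. x + wmax u) ` set (drop j v') \<union> set u"
    and "set (take j (u \<triangleleft>\<^sub>B v)) = (\<lambda>x. x + wmax u) ` set (take j v')"
    and "last (u \<triangleleft>\<^sub>B v) = l + wmax u"
    and "j < length (u \<triangleleft>\<^sub>B v)"
    using j unfolding ex butlast_snoc by (auto simp: shift_def take_map drop_map)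
  moreover have "butlast v = v'" "last v = l" "take j v = take j v'" using j by (auto simp: veq)
  ultimately show ?thesis
    unfolding blue_cut_def using less lv tv assms(4) by (auto simp: ball_Un)
qed

lemma red_factors_red_cut:
  assumes "red_factors w u v"
  shows "red_cut w (length u)"
  using assms red_cut_red_op[of u v 0] red_cut_0[of v] by (simp add: red_factors_def)

lemma blue_factors_blue_cut:
  assumes "blue_factors w u v"
  shows "blue_cut w (length v - 1)"
  using assms blue_cut_blue_op[of u v "length v - 1"] blue_cut_last[of v]
  by (simp add: blue_factors_def)

lemma red_cut_red_factors:
  assumes w: "packed w" "w \<noteq> []" and cut: "red_cut w k"
  obtains u v where "red_factors w u v" "length u = k"
proof -
  define p r M where "p = take k w" and "r = drop k w" and "M = wmax w"
  have weq: "w = p @ r" by (simp add: p_def r_def)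
  have lp: "length p = k" and Mp: "M \<notin> set p"
    and gt: "\<And>x y. x \<in> set p \<Longrightarrow> y \<in> set r \<Longrightarrow> y < x \<or> y = M"
    using cut by (auto simp: red_cut_def p_def r_def M_def)
  have sw: "set p \<union> set r = {1..M}" using w(1) unfolding packed_def M_def by (simp add: weq)
  have M: "1 \<le> M" "M \<in> set r"
    using wmax_packed_pos[OF w] wmax_in[OF w(2)] Mp by (auto simp: M_def weq)
  have "set p \<union> (set r - {M}) = {1..M} - {M}" using sw Mp by blast
  also have "\<dots> = {1..M - 1}" by auto
  finally obtain m where m: "m \<le> M - 1" "set r - {M} = {1..m}" "set p = {m + 1..M - 1}"
    using initial_segment_split[of "set p" "set r - {M}" "M - 1"] gt by blast
  define u v where "u = map (\<lambda>x. x - m) p" and "v = map (\<lambda>x. if x = M then m + 1 else x) r"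
  have "set p = (\<lambda>x. x + m) ` {1..M - 1 - m}"
    unfolding m(3) image_add_atLeastAtMost' using m(1) by (simp add: add.commute[of _ m]) arith
  then have su: "set u = {1..M - 1 - m}" by (simp only: u_def set_map image_image) simp
  have sr: "set r = insert M {1..m}" using m(2) M(2) by blast
  have sv: "set v = {1..m + 1}" unfolding v_def set_map sr using m(1) M(1) by auto
  have wu: "wmax u = M - 1 - m" and wv: "wmax v = m + 1"
    using packed_wmax su sv by blast+
  have pu: "packed u" and pv: "packed v" "v \<noteq> []" using su sv packed_iff by (blast, blast, auto)
  have "shift m u = p"
    unfolding u_def shift_def map_map by (rule map_idI) (use m(3) in auto)
  moreover have "map (\<lambda>x. if x = m + 1 then x + (M - 1 - m) else x) v = r"
    unfolding v_def map_map by (rule map_idI) (use sr m(1) M(1) in auto)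
  ultimately have "w = u \<triangleleft>\<^sub>R v"
    unfolding red_op_explicit[OF pu pv] wu wv weq by simp
  then have "red_factors w u v" using pu pv by (simp add: red_factors_def)
  then show ?thesis by (rule that) (simp add: u_def lp)
qed

lemma blue_cut_blue_factors:
  assumes w: "packed w" "w \<noteq> []" and cut: "blue_cut w j"
  obtains u v where "blue_factors w u v" "length v = Suc j"
proof -
  define p u l where "p = take j w" and "u = drop j (butlast w)" and "l = last w"
  have "take j w = take j (butlast w)" using cut by (simp add: blue_cut_def take_butlast)
  then have weq: "w = p @ u @ [l]"
    using w(2) by (metis append.assoc append_butlast_last_id append_take_drop_id l_def p_def u_def)
  have lp: "length p = j" using cut by (simp add: p_def blue_cut_def)
  have gt: "\<And>x y. y \<in> set p \<union> {l} \<Longrightarrow> x \<in> set u \<Longrightarrow> x < y"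
    using cut by (auto simp: blue_cut_def p_def u_def l_def)
  have "set p \<union> {l} \<union> set u = {1..wmax w}" using w(1) by (auto simp: packed_def weq)
  then obtain m where m: "m \<le> wmax w" "set u = {1..m}" "set p \<union> {l} = {m + 1..wmax w}"
    using initial_segment_split[of "set p \<union> {l}" "set u" "wmax w"] gt by blast
  define v where "v = map (\<lambda>x. x - m) (p @ [l])"
  have wu: "wmax u = m" and pu: "packed u" using m(2) packed_wmax packed_iff by (blast, blast)
  have "set (p @ [l]) = (\<lambda>x. x + m) ` {1..wmax w - m}"
    using m(1,3) by (simp add: image_add_atLeastAtMost')
  then have "set v = {1..wmax w - m}" by (simp only: v_def set_map image_image) simp
  then have pv: "packed v" "v \<noteq> []" using packed_iff by (blast, simp add: v_def)
  have ge: "m < x" if "x \<in> set p \<union> {l}" for x using that unfolding m(3) by simp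
  have "shift m (map (\<lambda>x. x - m) p) = p"
    unfolding shift_def map_map by (rule map_idI) (use ge in fastforce)
  moreover have "l - m + m = l" using ge[of l] by simp
  ultimately have "w = u \<triangleleft>\<^sub>B v"
    unfolding blue_op_explicit[OF pv] wu weq by (simp add: v_def butlast_append)
  then have "blue_factors w u v" using pu pv by (simp add: blue_factors_def)
  then show ?thesis by (rule that) (simp add: v_def lp)
qed

lemma irreducible_word_if_red_irreducible: "red_irreducible w \<Longrightarrow> irreducible_word w"
  by (simp add: red_irreducible_def)

lemma irreducible_word_if_blue_irreducible: "blue_irreducible w \<Longrightarrow> irreducible_word w"
  by (simp add: blue_irreducible_def)

lemma red_irreducible_iff_cut:
  assumes "irreducible_word w"
  shows "red_irreducible w \<longleftrightarrow> (\<forall>k. red_cut w k \<longrightarrow> k = 0)"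
proof -
  have w: "packed w" "w \<noteq> []" using assms by (auto simp: irreducible_word_def)
  show ?thesis
    using red_cut_red_factors[OF w] red_factors_red_cut assms
    unfolding red_irreducible_def by (metis length_0_conv)
qed

lemma blue_irreducible_iff_cut:
  assumes "irreducible_word w"
  shows "blue_irreducible w \<longleftrightarrow> (\<forall>j. blue_cut w j \<longrightarrow> Suc j = length w)"
proof -
  have w: "packed w" "w \<noteq> []" using assms by (auto simp: irreducible_word_def)
  have len: "length w = length u + length v \<and> v \<noteq> []" if "blue_factors w u v" for u v
    using that by (auto simp: blue_factors_def length_blue_op)
  show ?thesis
  proof
    assume irr: "blue_irreducible w"
    show "\<forall>j. blue_cut w j \<longrightarrow> Suc j = length w"
    proof (intro allI impI)
      fix j assume "blue_cut w j"
      then obtain u v where "blue_factors w u v" "length v = Suc j"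
        using blue_cut_blue_factors[OF w] by blast
      then show "Suc j = length w" using irr len by (fastforce simp: blue_irreducible_def)
    qed
  next
    assume "\<forall>j. blue_cut w j \<longrightarrow> Suc j = length w"
    then have "u = []" if "blue_factors w u v" for u v
      using blue_factors_blue_cut[OF that] len[OF that] by (cases v) auto
    then show "blue_irreducible w" using assms by (simp add: blue_irreducible_def)
  qed
qed


lemma red_factorization_iff:
  assumes "irreducible_word w"
  shows "red_factorization w = (u, v) \<longleftrightarrow> packed u \<and> red_irreducible v \<and> w = u \<triangleleft>\<^sub>R v"
proof -
  have w: "packed w" "w \<noteq> []" using assms by (auto simp: irreducible_word_def)
  obtain a x where ax: "red_factorization w = (a, x)" "red_factors w a x"
    and max: "\<And>u' v'. red_factors w u' v' \<Longrightarrow> length u' \<le> length a"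
    using red_factorization_exists[OF w] by blast
  have pk: "packed a" "packed x" "x \<noteq> []" "w = a \<triangleleft>\<^sub>R x"
    using ax(2) by (auto simp: red_factors_def)
  show ?thesis
  proof
    assume "red_factorization w = (u, v)"
    then have eq: "u = a" "v = x" using ax(1) by auto
    have "\<not> global_descent x c" for c
    proof
      assume gd: "global_descent x c"
      define m f where "m = wmax x" and "f = (\<lambda>y. if y = m then y + wmax a else y)"
      have ex: "w = shift (m - 1) a @ map f x"
        using red_op_explicit[OF pk(1-3)] pk(4) by (simp add: m_def f_def)
      have c: "1 \<le> c" "c < length x"
        and gt: "\<And>s t. s \<in> set (take c x) \<Longrightarrow> t \<in> set (drop c x) \<Longrightarrow> t < s"
        using gd by (auto simp: global_descent_def)
      have le: "y \<le> m" if "y \<in> set x" for y using wmax_ge[OF that] by (simp add: m_def)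
      have "take c x \<noteq> []" using c by auto
      then obtain s where s: "s \<in> set (take c x)" by (meson list.set_sel(1))
      have dlt: "t < m" if "t \<in> set (drop c x)" for t
        using gt[OF s that] le[of s] s by (auto dest: in_set_takeD)
      have "f t < f s" if "s \<in> set (take c x)" "t \<in> set (drop c x)" for s t
        using gt[OF that] dlt[OF that(2)] by (simp add: f_def)
      moreover have "f t < s + (m - 1)" if "s \<in> set a" "t \<in> set (drop c x)" for s t
        using dlt[OF that(2)] packed_letter_pos[OF pk(1) that(1)] by (simp add: f_def)
      ultimately have "global_descent w (length a + c)"
        using c unfolding ex global_descent_def
        by (auto simp: shift_def take_map drop_map)
      then show False using assms by (auto simp: irreducible_word_def)
    qed
    then have irr: "irreducible_word x" using pk by (simp add: irreducible_word_def)
    have "k = 0" if "red_cut x k" for k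
    proof -
      have "red_cut w (length a + k)" using that red_cut_red_op[OF pk(1-3)] pk(4) by simp
      then obtain u' v' where "red_factors w u' v'" "length u' = length a + k"
        using red_cut_red_factors[OF w] by blast
      then show "k = 0" using max by fastforce
    qed
    then show "packed u \<and> red_irreducible v \<and> w = u \<triangleleft>\<^sub>R v"
      using red_irreducible_iff_cut[OF irr] eq pk by simp
  next
    assume uv: "packed u \<and> red_irreducible v \<and> w = u \<triangleleft>\<^sub>R v"
    then have irr: "irreducible_word v" by (simp add: red_irreducible_def)
    then have v: "packed v" "v \<noteq> []" by (auto simp: irreducible_word_def)
    have fac: "red_factors w u v" using uv v by (simp add: red_factors_def)
    have "red_cut w (length u + (length a - length u))"
      using red_factors_red_cut[OF ax(2)] max[OF fac] by simp
    then have "red_cut v (length a - length u)" using red_cut_red_op[of u v] uv v by simp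
    then have "length u = length a"
      using uv red_irreducible_iff_cut[OF irr] max[OF fac] by fastforce
    then show "red_factorization w = (u, v)"
      using red_factors_unique[OF fac ax(2)] ax(1) by simp
  qed
qed

lemma blue_factorization_iff:
  assumes "irreducible_word w"
  shows "blue_factorization w = (u, v) \<longleftrightarrow> packed u \<and> blue_irreducible v \<and> w = u \<triangleleft>\<^sub>B v"
proof -
  have w: "packed w" "w \<noteq> []" using assms by (auto simp: irreducible_word_def)
  obtain b c where bc: "blue_factorization w = (b, c)" "blue_factors w b c"
    and max: "\<And>u' v'. blue_factors w u' v' \<Longrightarrow> length u' \<le> length b"
    using blue_factorization_exists[OF w] by blast
  have pk: "packed b" "packed c" "c \<noteq> []" "w = b \<triangleleft>\<^sub>B c"
    using bc(2) by (auto simp: blue_factors_def)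
  have len: "length w = length u + length v" if "blue_factors w u v" for u v
    using that by (auto simp: blue_factors_def length_blue_op)
  show ?thesis
  proof
    assume "blue_factorization w = (u, v)"
    then have eq: "u = b" "v = c" using bc(1) by auto
    have "\<not> global_descent c d" for d
    proof
      assume gd: "global_descent c d"
      define c' l where "c' = butlast c" and "l = last c"
      have ceq: "c = c' @ [l]" using pk by (simp add: c'_def l_def)
      have ex: "w = shift (wmax b) c' @ b @ [l + wmax b]"
        using blue_op_explicit[OF pk(2,3)] pk(4) by (simp add: c'_def l_def)
      have d: "1 \<le> d" "d \<le> length c'"
        and gt: "\<And>s t. s \<in> set (take d c') \<Longrightarrow> t \<in> set (drop d c') \<union> {l} \<Longrightarrow> t < s"
        using gd by (auto simp: global_descent_def ceq)
      have "t < s + wmax b" if "s \<in> set (take d c')" "t \<in> set b" for s t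
        using wmax_ge[OF that(2)] packed_letter_pos[OF pk(2), of s] that(1)
        by (auto simp: ceq dest: in_set_takeD)
      then have "global_descent w d"
        using d gt unfolding ex global_descent_def
        by (auto simp: shift_def take_map drop_map)
      then show False using assms by (auto simp: irreducible_word_def)
    qed
    then have irr: "irreducible_word c" using pk by (simp add: irreducible_word_def)
    have "Suc j = length c" if cut: "blue_cut c j" for j
    proof -
      have j: "j < length c" using cut by (simp add: blue_cut_def)
      then have "blue_cut w j" using cut blue_cut_blue_op[OF pk(1-3)] pk(4) by simp
      then obtain u' v' where "blue_factors w u' v'" "length v' = Suc j"
        using blue_cut_blue_factors[OF w] by blast
      then show "Suc j = length c" using max len len[OF bc(2)] j by fastforce
    qed
    then show "packed u \<and> blue_irreducible v \<and> w = u \<triangleleft>\<^sub>B v"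
      using blue_irreducible_iff_cut[OF irr] eq pk by simp
  next
    assume uv: "packed u \<and> blue_irreducible v \<and> w = u \<triangleleft>\<^sub>B v"
    then have irr: "irreducible_word v" by (simp add: blue_irreducible_def)
    then have v: "packed v" "v \<noteq> []" by (auto simp: irreducible_word_def)
    have fac: "blue_factors w u v" using uv v by (simp add: blue_factors_def)
    have le: "length c \<le> length v" using len[OF fac] len[OF bc(2)] max[OF fac] by simp
    have c1: "1 \<le> length c" using pk(3) by (cases c) auto
    have "blue_cut v (length c - 1)"
      using blue_factors_blue_cut[OF bc(2)] blue_cut_blue_op[of u v "length c - 1"] uv v le c1
      by simp
    then have "length c = length v"
      using uv blue_irreducible_iff_cut[OF irr] c1 by fastforce
    then have "length u = length b" using len[OF fac] len[OF bc(2)] by simp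
    then show "blue_factorization w = (u, v)"
      using blue_factors_unique[OF fac bc(2)] bc(1) by simp
  qed
qed

section \<open>Interaction of the two colors\<close>

lemma wmax_singleton: "wmax [x] = x"
  by (simp add: wmax_def)

lemma packed_one: "packed [1]"
  by (auto simp: packed_def wmax_singleton)

lemma irreducible_word_one: "irreducible_word [1]"
  using packed_one by (auto simp: irreducible_word_def global_descent_def)

lemma red_irreducible_one: "red_irreducible [1]"
  by (subst red_irreducible_iff_cut[OF irreducible_word_one]) (simp add: red_cut_def)

lemma blue_irreducible_one: "blue_irreducible [1]"
  by (subst blue_irreducible_iff_cut[OF irreducible_word_one]) (simp add: blue_cut_def)

lemma red_op_one: "packed u \<Longrightarrow> u \<triangleleft>\<^sub>R [1] = u @ [wmax u + 1]"
  using red_op_explicit[of u "[1]"] packed_one by (simp add: wmax_singleton shift_def)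

lemma blue_op_one: "u \<triangleleft>\<^sub>B [1] = u @ [wmax u + 1]"
  using blue_op_explicit[of "[1]" u] packed_one by (simp add: shift_def)

lemma red_irreducible_blue_op_one:
  assumes "packed b"
  shows "red_irreducible (b \<triangleleft>\<^sub>B [1]) \<longleftrightarrow> b = []"
proof
  assume irr: "red_irreducible (b \<triangleleft>\<^sub>B [1])"
  have "b \<triangleleft>\<^sub>B [1] = b \<triangleleft>\<^sub>R [1]"
    using red_op_one[OF assms] blue_op_one[of b] by simp
  then have "red_factors (b \<triangleleft>\<^sub>B [1]) b [1]"
    using assms packed_one by (simp add: red_factors_def)
  then show "b = []" using irr unfolding red_irreducible_def by blast
next
  assume "b = []"
  then show "red_irreducible (b \<triangleleft>\<^sub>B [1])"
    using red_irreducible_one Nil_blue_op[OF packed_one] by simp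
qed

lemma blue_irreducible_red_op_one:
  assumes "packed a"
  shows "blue_irreducible (a \<triangleleft>\<^sub>R [1]) \<longleftrightarrow> a = []"
proof
  assume irr: "blue_irreducible (a \<triangleleft>\<^sub>R [1])"
  have "a \<triangleleft>\<^sub>R [1] = a \<triangleleft>\<^sub>B [1]"
    using red_op_one[OF assms] blue_op_one[of a] by simp
  then have "blue_factors (a \<triangleleft>\<^sub>R [1]) a [1]"
    using assms packed_one by (simp add: blue_factors_def)
  then show "a = []" using irr unfolding blue_irreducible_def by blast
next
  assume "a = []"
  then show "blue_irreducible (a \<triangleleft>\<^sub>R [1])"
    using blue_irreducible_one Nil_red_op[OF packed_one] by simp
qed

lemma irreducible_word_snocE:
  assumes "irreducible_word c" "c \<noteq> [1]"
  obtains c' l where "c = c' @ [l]" "c' \<noteq> []"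
proof (cases c rule: rev_cases)
  case Nil
  then show ?thesis using assms by (simp add: irreducible_word_def)
next
  case (snoc c' l)
  moreover have "c' \<noteq> []"
  proof
    assume "c' = []"
    then have "{l} = {1..l}"
      using assms(1) snoc by (simp add: irreducible_word_def packed_def wmax_singleton)
    then have "l = 1" by (metis atLeastAtMost_singleton_iff)
    then show False using \<open>c' = []\<close> snoc assms(2) by simp
  qed
  ultimately show ?thesis by (rule that)
qed

lemma red_irreducible_blue_op:
  assumes b: "packed b" and c: "irreducible_word c" "c \<noteq> [1]"
  shows "red_irreducible (b \<triangleleft>\<^sub>B c) \<longleftrightarrow> red_irreducible c"
proof -
  obtain c' l where ceq: "c = c' @ [l]" and c': "c' \<noteq> []" using irreducible_word_snocE c by blast
  have pc: "packed c" "c \<noteq> []" using c by (auto simp: irreducible_word_def)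
  define m where "m = wmax c"
  define w where "w = b \<triangleleft>\<^sub>B c"
  have ex: "w = shift (wmax b) c' @ b @ [l + wmax b]"
    using blue_op_explicit[OF pc] by (simp add: w_def ceq)
  have wm: "wmax w = m + wmax b" using wmax_blue_op[OF b pc] by (simp add: w_def m_def)
  have len: "length w = length b + length c" using length_blue_op[OF pc] by (simp add: w_def)
  have low: "red_cut w k \<longleftrightarrow> red_cut c k" if k: "k \<le> length c'" for k
  proof -
    have "set (take k w) = (\<lambda>x. x + wmax b) ` set (take k c)"
      using k by (simp add: ex ceq shift_def take_map)
    moreover have "set (drop k w) = (\<lambda>x. x + wmax b) ` set (drop k c) \<union> set b"
      using k by (auto simp: ex ceq shift_def drop_map)
    moreover have "y < x + wmax b" if "x \<in> set (take k c)" "y \<in> set b" for x y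
      using wmax_ge[OF that(2)] packed_letter_pos[OF pc(1), of x] that(1)
      by (auto dest: in_set_takeD)
    ultimately show ?thesis
      unfolding red_cut_def wm m_def[symmetric] len using k ceq by (auto simp: ball_Un)
  qed
  \<comment> \<open>A cut beyond \<open>c'\<close> leaves the maximal letter only at the end, so \<open>c = c' \<triangleleft>\<^sub>R 1\<close>.\<close>
  have high: "red_cut c (length c')" if k: "length c' < k" "red_cut w k" for k
  proof -
    obtain d where "k = length c' + d" using k(1) by (metis less_imp_add_positive)
    then have "set (take k w) \<supseteq> (\<lambda>x. x + wmax b) ` set c'" by (auto simp: ex shift_def)
    then have "m \<notin> set c'" using k(2) by (auto simp: red_cut_def wm)
    then have "m = l" using wmax_in[OF pc(2)] by (simp add: m_def ceq)
    then show ?thesis using \<open>m \<notin> set c'\<close> by (simp add: red_cut_def m_def[symmetric]) (simp add: ceq)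
  qed
  have "(\<forall>k. red_cut w k \<longrightarrow> k = 0) \<longleftrightarrow> (\<forall>k. red_cut c k \<longrightarrow> k = 0)"
  proof
    assume *: "\<forall>k. red_cut w k \<longrightarrow> k = 0"
    show "\<forall>k. red_cut c k \<longrightarrow> k = 0"
    proof (intro allI impI)
      fix k assume k: "red_cut c k"
      then have "k \<le> length c'" by (simp add: red_cut_def ceq)
      then show "k = 0" using * low k by simp
    qed
  next
    assume "\<forall>k. red_cut c k \<longrightarrow> k = 0"
    then show "\<forall>k. red_cut w k \<longrightarrow> k = 0"
      using low high c' by (metis length_0_conv not_le)
  qed
  then show ?thesis
    using red_irreducible_iff_cut c(1) irreducible_blue_op[OF b c(1)] by (simp add: w_def)
qed

lemma blue_irreducible_red_op:
  assumes a: "packed a" and c: "irreducible_word c" "c \<noteq> [1]"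
  shows "blue_irreducible (a \<triangleleft>\<^sub>R c) \<longleftrightarrow> blue_irreducible c"
proof -
  obtain c' l where ceq: "c = c' @ [l]" and c': "c' \<noteq> []" using irreducible_word_snocE c by blast
  have pc: "packed c" "c \<noteq> []" using c by (auto simp: irreducible_word_def)
  define m where "m = wmax c"
  define f where "f = (\<lambda>x. if x = m then x + wmax a else x)"
  define w where "w = a \<triangleleft>\<^sub>R c"
  have ex: "w = (shift (m - 1) a @ map f c') @ [f l]"
    using red_op_explicit[OF a pc] by (simp add: w_def m_def f_def ceq)
  have len: "length w = length a + length c" using length_red_op[OF pc] by (simp add: w_def)
  have le: "x \<le> m" if "x \<in> set c" for x using wmax_ge[OF that] by (simp add: m_def)
  have f_less: "f y < f x \<longleftrightarrow> y < x" if "x \<in> set c" "y \<in> set c" for x y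
    using le[OF that(1)] le[OF that(2)] by (auto simp: f_def)
  have l: "l \<in> set c" by (simp add: ceq)
  have lastw: "last w = f l" by (simp add: ex)
  have mid: "blue_cut w (length a + j) \<longleftrightarrow> blue_cut c j" if j: "j \<le> length c'" for j
  proof -
    have "set (drop (length a + j) (butlast w)) = f ` set (drop j (butlast c))"
      unfolding ex butlast_snoc ceq by (simp add: shift_def drop_map)
    moreover have "set (take (length a + j) w) = (\<lambda>x. x + (m - 1)) ` set a \<union> f ` set (take j c)"
      using j by (simp add: ex ceq shift_def take_map)
    moreover have "f x < y + (m - 1)" if "x \<in> set c" "x < l" "y \<in> set a" for x y
      using that le[OF l] packed_letter_pos[OF a that(3)] by (simp add: f_def)
    moreover have "\<And>x. x \<in> set (drop j (butlast c)) \<Longrightarrow> x \<in> set c"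
      by (auto dest: in_set_dropD in_set_butlastD)
    moreover have "\<And>x. x \<in> set (take j c) \<Longrightarrow> x \<in> set c" by (auto dest: in_set_takeD)
    moreover have "last c = l" "length a + j < length w" "j < length c"
      using j by (auto simp: ceq len)
    ultimately show ?thesis
      unfolding blue_cut_def lastw using f_less l by (auto simp: ball_Un)
  qed
  have low: "blue_cut c 0" if j: "j < length a" "blue_cut w j" for j
  proof -
    have "set (drop j (butlast w)) \<supseteq> f ` set c'"
      using j(1) unfolding ex butlast_snoc by (simp add: shift_def)
    then have "f x < f l" if "x \<in> set c'" for x
      using j(2) that unfolding blue_cut_def lastw by blast
    then have "x < l" if "x \<in> set c'" for x using f_less[OF l, of x] that ceq by simp
    then show ?thesis by (simp add: blue_cut_def ceq)
  qed
  have "(\<forall>j. blue_cut w j \<longrightarrow> Suc j = length w) \<longleftrightarrow> (\<forall>j. blue_cut c j \<longrightarrow> Suc j = length c)"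
  proof
    assume *: "\<forall>j. blue_cut w j \<longrightarrow> Suc j = length w"
    show "\<forall>j. blue_cut c j \<longrightarrow> Suc j = length c"
    proof (intro allI impI)
      fix j assume j: "blue_cut c j"
      then have "j \<le> length c'" by (simp add: blue_cut_def ceq)
      then have "Suc (length a + j) = length w" using * mid j by blast
      then show "Suc j = length c" using len by simp
    qed
  next
    assume *: "\<forall>j. blue_cut c j \<longrightarrow> Suc j = length c"
    show "\<forall>j. blue_cut w j \<longrightarrow> Suc j = length w"
    proof (intro allI impI)
      fix j assume j: "blue_cut w j"
      have "length a \<le> j"
        using low[OF _ j] * c' by (fastforce simp: ceq)
      then obtain i where i: "j = length a + i" by (metis le_iff_add)
      then have "i \<le> length c'" using j by (simp add: blue_cut_def len ceq)
      then show "Suc j = length w" using mid j i * len by simp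
    qed
  qed
  then show ?thesis
    using blue_irreducible_iff_cut c(1) irreducible_red_op[OF a c(1)] by (simp add: w_def)
qed

section \<open>The tree codings\<close>

text \<open>
  The two codings differ by exchanging the colors and reversing the order of forests;
  \<open>arrange\<close> is the identity for \<open>F_RB\<close> and the reversal for \<open>F_BR\<close>.
\<close>

locale tree_coding =
  fixes op1 op2 :: "word \<Rightarrow> word \<Rightarrow> word"
    and fact1 fact2 :: "word \<Rightarrow> word \<times> word"
    and irr1 irr2 :: "word \<Rightarrow> bool"
    and arrange :: "word list \<Rightarrow> word list"
    and F :: "word \<Rightarrow> word biplane_forest" and T :: "word \<Rightarrow> word biplane_tree"
    and T_star :: "word biplane_tree \<Rightarrow> word"
  assumes irr1: "irr1 x \<Longrightarrow> irreducible_word x"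
    and irr2: "irr2 x \<Longrightarrow> irreducible_word x"
    and irr_both: "irr1 x \<and> irr2 x \<longleftrightarrow> red_irreducible x \<and> blue_irreducible x"
    and irr_one: "irr1 [1]" "irr2 [1]"
    and irr1_op2: "\<lbrakk>packed u; irreducible_word v; v \<noteq> [1]\<rbrakk> \<Longrightarrow> irr1 (op2 u v) \<longleftrightarrow> irr1 v"
    and irr1_op2_one: "packed u \<Longrightarrow> irr1 (op2 u [1]) \<longleftrightarrow> u = []"
    and irreducible_op1: "\<lbrakk>packed u; irreducible_word v\<rbrakk> \<Longrightarrow> irreducible_word (op1 u v)"
    and length_op1: "\<lbrakk>packed v; v \<noteq> []\<rbrakk> \<Longrightarrow> length (op1 u v) = length u + length v"
    and length_op2: "\<lbrakk>packed v; v \<noteq> []\<rbrakk> \<Longrightarrow> length (op2 u v) = length u + length v"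
    and fact1_iff:
      "irreducible_word w \<Longrightarrow> fact1 w = (u, v) \<longleftrightarrow> packed u \<and> irr1 v \<and> w = op1 u v"
    and fact2_iff:
      "irreducible_word w \<Longrightarrow> fact2 w = (u, v) \<longleftrightarrow> packed u \<and> irr2 v \<and> w = op2 u v"
    and set_arrange [simp]: "set (arrange ws) = set ws"
    and arrange_arrange [simp]: "arrange (arrange ws) = ws"
    and sum_list_arrange: "sum_list (map length (arrange ws)) = sum_list (map length ws)"
    and F_eq: "packed w \<Longrightarrow> F w = map T (arrange (irreducible_decomposition w))"
    and T_eq: "\<lbrakk>irreducible_word w; fact1 w = (a, x); fact2 x = (b, c)\<rbrakk>
      \<Longrightarrow> T w = Node c (F a) (F b)"
    and T_star_eq: "T_star (Node c fl fr) =
      op1 (odot_list (arrange (map T_star fl))) (op2 (odot_list (arrange (map T_star fr))) c)"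
begin

definition F_star :: "word biplane_forest \<Rightarrow> word" where
  "F_star f = odot_list (arrange (map T_star f))"

lemma length_odot_list: "length (odot_list ws) = sum_list (map length ws)"
  by (induction ws) auto

lemma length_F_star: "length (F_star f) = sum_list (map (length \<circ> T_star) f)"
  by (simp add: F_star_def length_odot_list sum_list_arrange)

lemma irreducible_decomposition_odot_list:
  assumes "\<forall>x \<in> set ws. irreducible_word x"
  shows "irreducible_decomposition (odot_list ws) = ws"
proof -
  have "packed (odot_list ws)"
    using assms by (auto intro: packed_odot_list simp: irreducible_word_def)
  from irreducible_decomposition[OF this] show ?thesis
    using irreducible_decomposition_unique assms by blast
qed

definition decodes :: "word biplane_tree \<Rightarrow> word \<Rightarrow> bool" where
  "decodes t w \<longleftrightarrow> irreducible_word w \<and> bicolored_packed t \<and> tree_weight t = length w \<and>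
     T w = t \<and> T_star t = w"

definition forest_decodes :: "word biplane_forest \<Rightarrow> word \<Rightarrow> bool" where
  "forest_decodes f w \<longleftrightarrow> packed w \<and> (\<forall>t \<in> set f. bicolored_packed t) \<and>
     forest_weight f = length w \<and> F w = f \<and> F_star f = w"

lemma forest_decodes_F_star:
  assumes "\<And>t. t \<in> set f \<Longrightarrow> decodes t (T_star t)"
  shows "forest_decodes f (F_star f)"
proof -
  let ?ws = "arrange (map T_star f)"
  have irr: "\<forall>x \<in> set ?ws. irreducible_word x" using assms by (auto simp: decodes_def)
  then have pk: "packed (F_star f)"
    unfolding F_star_def by (intro packed_odot_list) (auto simp: irreducible_word_def)
  have "F (F_star f) = map T (map T_star f)"
    using irreducible_decomposition_odot_list[OF irr] F_eq[OF pk] by (simp add: F_star_def)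
  also have "\<dots> = f"
    unfolding map_map by (rule map_idI) (use assms in \<open>simp add: decodes_def\<close>)
  finally have "F (F_star f) = f" .
  moreover have "forest_weight f = length (F_star f)"
    unfolding forest_weight_def length_F_star
    by (intro arg_cong[where f = sum_list] map_cong refl) (use assms in \<open>auto simp: decodes_def\<close>)
  ultimately show ?thesis using pk assms by (auto simp: forest_decodes_def decodes_def)
qed

lemma forest_decodes_F:
  assumes w: "packed w"
    and dec: "\<And>x. irreducible_word x \<Longrightarrow> length x \<le> length w \<Longrightarrow> decodes (T x) x"
  shows "forest_decodes (F w) w"
proof -
  let ?ws = "irreducible_decomposition w"
  have *: "decodes (T x) x" if "x \<in> set ?ws" for x
    using dec irreducible_decomposition(1)[OF w] irreducible_decomposition_length[OF w that] that
    by blast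
  have F: "F w = map T (arrange ?ws)" using F_eq[OF w] .
  have "map T_star (F w) = arrange ?ws"
    unfolding F map_map by (rule map_idI) (use * in \<open>auto simp: decodes_def\<close>)
  then have "F_star (F w) = w"
    using irreducible_decomposition(2)[OF w] by (simp add: F_star_def)
  moreover have "forest_decodes (F w) (F_star (F w))"
    by (rule forest_decodes_F_star) (use * F in \<open>auto simp: decodes_def\<close>)
  ultimately show ?thesis by simp
qed

lemma decodes_Node:
  assumes a: "forest_decodes fl a" and b: "forest_decodes fr b"
    and c: "irr2 c" and x: "irr1 (op2 b c)"
  shows "decodes (Node c fl fr) (op1 a (op2 b c))"
proof -
  let ?x = "op2 b c" and ?w = "op1 a (op2 b c)"
  have pa: "packed a" and pb: "packed b"
    and Fa: "F a = fl" "F_star fl = a" and Fb: "F b = fr" "F_star fr = b"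
    using a b by (auto simp: forest_decodes_def)
  have irrc: "irreducible_word c" and irrx: "irreducible_word ?x"
    using irr1 irr2 c x by auto
  have irrw: "irreducible_word ?w" using irreducible_op1 pa irrx by blast
  have ne: "packed c" "c \<noteq> []" "packed ?x" "?x \<noteq> []"
    using irrc irrx by (auto simp: irreducible_word_def)
  have "fact1 ?w = (a, ?x)" using fact1_iff[OF irrw] pa x by blast
  moreover have "fact2 ?x = (b, c)" using fact2_iff[OF irrx] pb c by blast
  ultimately have T: "T ?w = Node c fl fr" using T_eq[OF irrw] Fa Fb by simp
  have Ts: "T_star (Node c fl fr) = ?w"
    using Fa(2) Fb(2) by (simp add: T_star_eq F_star_def)
  have wt: "tree_weight (Node c fl fr) = length ?w"
    using a b by (simp add: length_op1 length_op2 ne forest_decodes_def forest_weight_def)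
  have trees: "\<forall>t \<in> set fl. bicolored_packed t" "\<forall>t \<in> set fr. bicolored_packed t"
    using a b by (auto simp: forest_decodes_def)
  have "bicolored_packed (Node c fl fr)"
  proof (cases "c = [1]")
    case True
    then have "b = []" using irr1_op2_one[OF pb] x by simp
    moreover have "arrange [] = []" using set_arrange[of "[]"] by (metis set_empty)
    ultimately have "fr = []"
      using Fb(1) F_eq[of "[]"] irreducible_decomposition_odot_list[of "[]"] by simp
    then show ?thesis using True trees by simp
  next
    case False
    then have "irr1 c" using irr1_op2[OF pb irrc] x by simp
    then show ?thesis using False c trees irr_both by auto
  qed
  then show ?thesis using irrw T Ts wt by (simp add: decodes_def)
qed

lemma decodes_T: "irreducible_word w \<Longrightarrow> decodes (T w) w"
proof (induction w rule: length_induct)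
  case (1 w)
  obtain a x where ax: "fact1 w = (a, x)" by (meson surj_pair)
  then have a: "packed a" "irr1 x" "w = op1 a x" using fact1_iff 1(2) by auto
  have irrx: "irreducible_word x" using irr1 a by blast
  obtain b c where bc: "fact2 x = (b, c)" by (meson surj_pair)
  then have b: "packed b" "irr2 c" "x = op2 b c" using fact2_iff irrx by auto
  have irrc: "irreducible_word c" using irr2 b by blast
  have "packed x" "x \<noteq> []" "packed c" "c \<noteq> []"
    using irrx irrc by (auto simp: irreducible_word_def)
  then have len: "length a < length w" "length b < length w"
    using a(3) b(3) length_op1[of x a] length_op2[of c b] by auto
  have "forest_decodes (F a) a" "forest_decodes (F b) b"
    by (rule forest_decodes_F; use a(1) b(1) 1(1) len in fastforce)+
  then have "decodes (Node c (F a) (F b)) w"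
    using decodes_Node a b by metis
  moreover have "T w = Node c (F a) (F b)" using T_eq[OF 1(2) ax bc] .
  ultimately show ?case by simp
qed

lemma decodes_T_star: "bicolored_packed t \<Longrightarrow> decodes t (T_star t)"
proof (induction t)
  case (Node c fl fr)
  have fl: "forest_decodes fl (F_star fl)"
    by (rule forest_decodes_F_star) (use Node in auto)
  have fr: "forest_decodes fr (F_star fr)"
    by (rule forest_decodes_F_star) (use Node in auto)
  have eq: "T_star (Node c fl fr) = op1 (F_star fl) (op2 (F_star fr) c)"
    by (simp add: T_star_eq F_star_def)
  have pk: "packed (F_star fr)" using fr by (simp add: forest_decodes_def)
  have "irr2 c \<and> irr1 (op2 (F_star fr) c)"
  proof (cases "c = [1]")
    case True
    then have "length (F_star fr) = 0" using Node.prems red_irreducible_one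
      by (simp add: length_F_star)
    then show ?thesis using True irr_one irr1_op2_one[OF pk] by simp
  next
    case False
    then have "irr1 c" "irr2 c" using Node.prems irr_both by auto
    then show ?thesis using irr1_op2[OF pk irr1 False] by simp
  qed
  then show ?case unfolding eq using decodes_Node fl fr by blast
qed

lemma T_bijection:
  shows "bij_betw T {w \<in> PW n. irreducible_word w} (bicolored_packed_trees n)"
    and "\<forall>w \<in> {w \<in> PW n. irreducible_word w}. T_star (T w) = w"
    and "\<forall>t \<in> bicolored_packed_trees n. T (T_star t) = t"
proof -
  show 1: "\<forall>w \<in> {w \<in> PW n. irreducible_word w}. T_star (T w) = w"
    and 2: "\<forall>t \<in> bicolored_packed_trees n. T (T_star t) = t"
    using decodes_T decodes_T_star by (auto simp: decodes_def bicolored_packed_trees_def)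
  show "bij_betw T {w \<in> PW n. irreducible_word w} (bicolored_packed_trees n)"
    by (rule bij_betw_byWitness[OF 1 2])
      (use decodes_T decodes_T_star in
        \<open>auto simp: decodes_def bicolored_packed_trees_def PW_def irreducible_word_def\<close>)
qed

lemma F_bijection:
  shows "bij_betw F (PW n) (bicolored_packed_forests n)"
    and "\<forall>w \<in> PW n. F_star (F w) = w"
    and "\<forall>f \<in> bicolored_packed_forests n. F (F_star f) = f"
proof -
  have dec: "forest_decodes (F w) w" if "packed w" for w
    using forest_decodes_F[OF that] decodes_T by blast
  have dec_star: "forest_decodes f (F_star f)" if "\<forall>t \<in> set f. bicolored_packed t" for f
    using forest_decodes_F_star decodes_T_star that by blast
  show 1: "\<forall>w \<in> PW n. F_star (F w) = w"
    and 2: "\<forall>f \<in> bicolored_packed_forests n. F (F_star f) = f"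
    using dec dec_star by (auto simp: forest_decodes_def bicolored_packed_forests_def PW_def)
  show "bij_betw F (PW n) (bicolored_packed_forests n)"
    by (rule bij_betw_byWitness[OF 1 2])
      (use dec dec_star in \<open>auto simp: forest_decodes_def bicolored_packed_forests_def PW_def\<close>)
qed

end

fun T_BR_star :: "word biplane_tree \<Rightarrow> word" where
  "T_BR_star (Node c fl fr) = odot_list (rev (map T_BR_star fl)) \<triangleleft>\<^sub>B
     (odot_list (rev (map T_BR_star fr)) \<triangleleft>\<^sub>R c)"

lemma F_RB_star_conv: "F_RB_star f = odot_list (map T_RB_star f)"
  by (induction f) auto

lemma F_RB_eq: "packed w \<Longrightarrow> F_RB w = map T_RB (irreducible_decomposition w)"
  by (simp add: F_RB.simps)

lemma F_BR_eq: "packed w \<Longrightarrow> F_BR w = map T_BR (rev (irreducible_decomposition w))"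
  by (simp add: F_BR.simps)

lemma T_RB_eq:
  "\<lbrakk>irreducible_word w; red_factorization w = (a, x); blue_factorization x = (b, c)\<rbrakk>
    \<Longrightarrow> T_RB w = Node c (F_RB a) (F_RB b)"
  by (simp add: T_RB.simps)

lemma T_BR_eq:
  "\<lbrakk>irreducible_word w; blue_factorization w = (b, y); red_factorization y = (a, c)\<rbrakk>
    \<Longrightarrow> T_BR w = Node c (F_BR b) (F_BR a)"
  by (simp add: T_BR.simps)

lemma sum_list_map_rev: "sum_list (map f (rev xs)) = sum_list (map f xs)"
  for f :: "'a \<Rightarrow> 'b::comm_monoid_add"
  by (metis rev_map sum_list_rev)

interpretation RB: tree_coding "(\<triangleleft>\<^sub>R)" "(\<triangleleft>\<^sub>B)" red_factorization blue_factorization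
  red_irreducible blue_irreducible "\<lambda>ws. ws" F_RB T_RB T_RB_star
  by unfold_locales
    ((fact red_irreducible_one blue_irreducible_one red_irreducible_blue_op
        blue_irreducible_red_op red_irreducible_blue_op_one blue_irreducible_red_op_one
        irreducible_red_op irreducible_blue_op length_red_op length_blue_op
        red_factorization_iff blue_factorization_iff irreducible_word_if_red_irreducible
        irreducible_word_if_blue_irreducible F_RB_eq T_RB_eq refl) |
      simp add: F_RB_star_conv)+

interpretation BR: tree_coding "(\<triangleleft>\<^sub>B)" "(\<triangleleft>\<^sub>R)" blue_factorization red_factorization
  blue_irreducible red_irreducible rev F_BR T_BR T_BR_star
  by unfold_locales
    ((fact red_irreducible_one blue_irreducible_one red_irreducible_blue_op
        blue_irreducible_red_op red_irreducible_blue_op_one blue_irreducible_red_op_one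
        irreducible_red_op irreducible_blue_op length_red_op length_blue_op
        red_factorization_iff blue_factorization_iff irreducible_word_if_red_irreducible
        irreducible_word_if_blue_irreducible F_BR_eq T_BR_eq T_BR_star.simps
        conj_commute set_rev rev_rev_ident sum_list_map_rev))+

theorem mainTheorem7:
  fixes n :: nat
  shows "bij_betw F_RB (PW n) (bicolored_packed_forests n)
    \<and> bij_betw T_RB {w \<in> PW n. irreducible_word w} (bicolored_packed_trees n)
    \<and> (\<forall>w \<in> PW n. F_RB_star (F_RB w) = w)
    \<and> (\<forall>f \<in> bicolored_packed_forests n. F_RB (F_RB_star f) = f)
    \<and> (\<forall>w \<in> {w \<in> PW n. irreducible_word w}. T_RB_star (T_RB w) = w)
    \<and> (\<forall>t \<in> bicolored_packed_trees n. T_RB (T_RB_star t) = t)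
    \<and> bij_betw F_BR (PW n) (bicolored_packed_forests n)
    \<and> bij_betw T_BR {w \<in> PW n. irreducible_word w} (bicolored_packed_trees n)"
  using RB.F_bijection[of n, unfolded RB.F_star_def, folded F_RB_star_conv]
    RB.T_bijection[of n] BR.F_bijection(1)[of n] BR.T_bijection(1)[of n]
  by (intro conjI)

end
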